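(* Let $n>1$ be an integer, let $K\ge1$, $K'\ge0$ and $\widetilde{\Lambda}$ be real constants, and let $f:B^n\to\mathbb{C}^n$ be a $(K,K')$-quasiregular pluriharmonic mapping such that $f(0)=0$, $\widetilde{\lambda}_f(0)=1$ and $\widetilde{\Lambda}_f(z)\le\widetilde{\Lambda}$ for all $z\in B^n$. Then $f$ is univalent on the ball $B^n(0,\rho)$ and $f(B^n(0,\rho))$ contains the ball $B^n(0,R)$, where $$\rho=\frac{\pi}{4(K+K'+\widetilde{\Lambda})}\quad\text{and}\quad R=\frac{\pi}{8(K+K'+\widetilde{\Lambda})}.$$
   Context: $B^n(z_0,r)=\{z\in\mathbb{C}^n:|z-z_0|<r\}$ for the Euclidean norm, and $B^n=B^n(0,1)$. A continuous complex-valued function $\phi$ on a domain $\Omega\subset\mathbb{C}^n$ is pluriharmonic if for each $z'\in\Omega$ and $\theta\in\partial B^n$ the function $\zeta\mapsto\phi(z'+\theta\zeta)$ is harmonic in $\{\zeta\in\mathbb{C}:|\zeta|<d_\Omega(z')\}$, where $d_\Omega(z')$ is the distance from $z'$ to $\partial\Omega$. A mapping into $\mathbb{C}^n$ is pluriharmonic if every component is pluriharmonic. For a continuously differentiable $f=(f_1,\dots,f_n):B^n\to\mathbb{C}^n$, $f_z=(\partial f_j/\partial z_k)$ and $f_{\bar z}=(\partial f_j/\partial\bar z_k)$ are $n\times n$ matrices, and $$\widetilde{\Lambda}_f(z)=\max_{\theta\in\partial B^n}|f_z(z)\theta+f_{\bar z}(z)\bar\theta|,\qquad \widetilde{\lambda}_f(z)=\min_{\theta\in\partial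 B^n}|f_z(z)\theta+f_{\bar z}(z)\bar\theta|,$$ with $\theta$ regarded as a column vector. For $K\ge1$, $K'\ge0$, a pluriharmonic mapping $f:B^n\to\mathbb{C}^n$ is called a $(K,K')$-quasiregular pluriharmonic mapping if $\widetilde{\Lambda}_f(z)\le K\,\widetilde{\lambda}_f(z)^{1/n}+K'$ for all $z\in B^n$. Univalent means injective. *)

theory Defs
  imports "HOL-Analysis.Analysis"
begin

text \<open>Over the reals throughout: for \<open>'a = complex\<close> the set \<open>Basis\<close> is \<open>{1, \<i>}\<close>, so the
  directions below are those of \<open>\<partial>/\<partial>x\<close> and \<open>\<partial>/\<partial>y\<close>.\<close>

definition deriv_dir :: "'a::real_normed_vector \<Rightarrow> ('a \<Rightarrow> 'b::real_normed_vector) \<Rightarrow> 'a \<Rightarrow> 'b" where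
  "deriv_dir v u z = frechet_derivative u (at z) v"

definition C1_on :: "('a::euclidean_space \<Rightarrow> 'b::real_normed_vector) \<Rightarrow> 'a set \<Rightarrow> bool" where
  "C1_on u S \<longleftrightarrow> (\<forall>z\<in>S. u differentiable (at z)) \<and> (\<forall>v\<in>Basis. continuous_on S (deriv_dir v u))"

definition C2_on :: "('a::euclidean_space \<Rightarrow> 'b::real_normed_vector) \<Rightarrow> 'a set \<Rightarrow> bool" where
  "C2_on u S \<longleftrightarrow> C1_on u S \<and> (\<forall>v\<in>Basis. C1_on (deriv_dir v u) S)"

definition laplacian :: "('a::euclidean_space \<Rightarrow> 'b::real_normed_vector) \<Rightarrow> 'a \<Rightarrow> 'b" where
  "laplacian u z = (\<Sum>v\<in>Basis. deriv_dir v (deriv_dir v u) z)"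

text \<open>Meant for open \<open>S\<close>.\<close>

definition harmonic_on :: "('a::euclidean_space \<Rightarrow> 'b::real_normed_vector) \<Rightarrow> 'a set \<Rightarrow> bool" where
  "harmonic_on u S \<longleftrightarrow> C2_on u S \<and> (\<forall>z\<in>S. laplacian u z = 0)"

text \<open>The norm of \<^typ>\<open>complex^'n\<close> is the Euclidean norm, and \<open>\<zeta> *s \<theta>\<close> is complex scalar
  multiplication. The disc has radius the distance from \<open>z\<close> to the boundary of \<open>\<Omega>\<close>. That distance
  is infinite if the boundary is empty, whereas \<^term>\<open>infdist z {}\<close> is 0, hence the guard.\<close>

definition slice_disc :: "(complex^'n) set \<Rightarrow> complex^'n \<Rightarrow> complex set" where
  "slice_disc \<Omega> z = {\<zeta>. frontier \<Omega> \<noteq> {} \<longrightarrow> norm \<zeta> < infdist z (frontier \<Omega>)}"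

definition pluriharmonic_on :: "(complex^'n \<Rightarrow> complex) \<Rightarrow> (complex^'n) set \<Rightarrow> bool" where
  "pluriharmonic_on \<phi> \<Omega> \<longleftrightarrow> open \<Omega> \<and> connected \<Omega> \<and> continuous_on \<Omega> \<phi> \<and>
     (\<forall>z\<in>\<Omega>. \<forall>\<theta>\<in>sphere 0 1. harmonic_on (\<lambda>\<zeta>. \<phi> (z + \<zeta> *s \<theta>)) (slice_disc \<Omega> z))"

definition pluriharmonic_mapping_on ::
    "(complex^'n \<Rightarrow> complex^'m) \<Rightarrow> (complex^'n) set \<Rightarrow> bool" where
  "pluriharmonic_mapping_on f \<Omega> \<longleftrightarrow> (\<forall>j. pluriharmonic_on (\<lambda>z. f z $ j) \<Omega>)"

text \<open>Wirtinger derivatives \<open>\<partial>/\<partial>z\<^sub>k = (\<partial>/\<partial>x\<^sub>k - \<i> \<partial>/\<partial>y\<^sub>k) / 2\<close> and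
  \<open>\<partial>/\<partial>\<^bold>z\<^sub>k = (\<partial>/\<partial>x\<^sub>k + \<i> \<partial>/\<partial>y\<^sub>k) / 2\<close> (bold for the conjugate variable), with
  \<open>z\<^sub>k = x\<^sub>k + \<i> y\<^sub>k\<close>; the directions of \<open>x\<^sub>k\<close> and \<open>y\<^sub>k\<close> are \<open>axis k 1\<close> and
  \<open>axis k \<i>\<close>.\<close>

definition wirtinger :: "'n \<Rightarrow> (complex^'n \<Rightarrow> complex) \<Rightarrow> complex^'n \<Rightarrow> complex" where
  "wirtinger k \<phi> z = (deriv_dir (axis k 1) \<phi> z - \<i> * deriv_dir (axis k \<i>) \<phi> z) / 2"

definition wirtinger_bar :: "'n \<Rightarrow> (complex^'n \<Rightarrow> complex) \<Rightarrow> complex^'n \<Rightarrow> complex" where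
  "wirtinger_bar k \<phi> z = (deriv_dir (axis k 1) \<phi> z + \<i> * deriv_dir (axis k \<i>) \<phi> z) / 2"

definition jac_z :: "(complex^'n \<Rightarrow> complex^'m) \<Rightarrow> complex^'n \<Rightarrow> complex^'n^'m" where
  "jac_z f z = (\<chi> j k. wirtinger k (\<lambda>w. f w $ j) z)"

definition jac_zbar :: "(complex^'n \<Rightarrow> complex^'m) \<Rightarrow> complex^'n \<Rightarrow> complex^'n^'m" where
  "jac_zbar f z = (\<chi> j k. wirtinger_bar k (\<lambda>w. f w $ j) z)"

definition cnj_vec :: "complex^'n \<Rightarrow> complex^'n" where
  "cnj_vec \<theta> = (\<chi> k. cnj (\<theta> $ k))"

text \<open>The supremum and infimum below are a maximum and a minimum: the expression is continuous
  in \<open>\<theta>\<close> and the unit sphere is compact and nonempty.\<close>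

definition Lambda_max :: "(complex^'n \<Rightarrow> complex^'n) \<Rightarrow> complex^'n \<Rightarrow> real" where
  "Lambda_max f z = (SUP \<theta>\<in>sphere 0 1. norm (jac_z f z *v \<theta> + jac_zbar f z *v cnj_vec \<theta>))"

definition lambda_min :: "(complex^'n \<Rightarrow> complex^'n) \<Rightarrow> complex^'n \<Rightarrow> real" where
  "lambda_min f z = (INF \<theta>\<in>sphere 0 1. norm (jac_z f z *v \<theta> + jac_zbar f z *v cnj_vec \<theta>))"

definition quasiregular_pluriharmonic ::
    "real \<Rightarrow> real \<Rightarrow> (complex^'n \<Rightarrow> complex^'n) \<Rightarrow> bool" where
  "quasiregular_pluriharmonic K K' f \<longleftrightarrow> pluriharmonic_mapping_on f (ball 0 1) \<and>
     (\<forall>z\<in>ball 0 1. Lambda_max f z \<le> K * lambda_min f z powr (1 / real CARD('n)) + K')"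

end

theory Submission
  imports Defs "HOL-Complex_Analysis.Complex_Analysis"
begin

text \<open>
  Write \<open>D z\<close> for the real derivative of \<open>f\<close> at \<open>z\<close>. The hypotheses say that \<open>D 0\<close> does not
  shrink any vector, that \<open>D 0\<close> stretches by at most \<open>K + K'\<close>, and that \<open>D z\<close> stretches by at
  most \<open>\<Lambda>\<close> everywhere. For a unit vector \<open>v\<close> the map \<open>z \<mapsto> D z v - D 0 v\<close> is pluriharmonic,
  vanishes at 0 and is bounded by \<open>K + K' + \<Lambda>\<close>, so the Schwarz lemma for harmonic maps
  (\<open>weakly_harmonic_Schwarz\<close>) gives \<open>norm (D z v - D 0 v) \<le> 4 (K + K' + \<Lambda>) / \<pi> * norm z\<close>, that
  is, \<open>norm z / \<rho>\<close>, where \<open>\<rho> = \<pi> / (4 (K + K' + \<Lambda>))\<close> is the radius claimed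
  (\<open>derivative_variation_of_harmonic_slices\<close>). On every closed ball of radius less than \<open>\<rho>\<close> the map
  \<open>f - D 0\<close> is thus a strict contraction, whence injectivity; integrating the estimate along radii
  costs \<open>\<rho> / 2\<close> on the sphere of radius \<open>\<rho>\<close>, whence a covered ball of radius \<open>\<rho> - \<rho> / 2\<close>
  (\<open>quantitative_inverse_function\<close>).

  Pluriharmonicity is given as continuity plus harmonicity on complex discs, so the
  differentiability of \<open>f\<close> has to be established first. The same Schwarz lemma does it: applied
  to the difference of two parallel slices it shows that directional derivatives depend
  continuously on the point (\<open>differentiable_of_harmonic_slices\<close>). The lemma in turn rests on
  writing a harmonic function on a disc as \<open>F + cnj G\<close> with holomorphic \<open>F\<close> and \<open>G\<close>
  (\<open>harmonic_on_convex_decomposition\<close>).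
\<close>

section \<open>Symmetry of mixed directional derivatives\<close>

lemma directional_derivative_along_line:
  fixes u :: "'a::real_normed_vector \<Rightarrow> 'b::real_normed_vector"
  assumes "\<And>x. x \<in> S \<Longrightarrow> ((\<lambda>t. u (x + t *\<^sub>R v)) has_vector_derivative p x) (at 0)"
    and "x + t *\<^sub>R v \<in> S"
  shows "((\<lambda>t. u (x + t *\<^sub>R v)) has_vector_derivative p (x + t *\<^sub>R v)) (at t)"
proof -
  let ?D = "\<lambda>h. h *\<^sub>R p (x + t *\<^sub>R v)"
  have "((\<lambda>s. s - t) has_derivative (\<lambda>h. h)) (at t)"
    by (rule derivative_eq_intros refl | simp)+
  moreover have "((\<lambda>s. u (x + t *\<^sub>R v + s *\<^sub>R v)) has_derivative ?D) (at (t - t))"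
    using assms by (simp add: has_vector_derivative_def)
  ultimately have "((\<lambda>s. u (x + t *\<^sub>R v + (s - t) *\<^sub>R v)) has_derivative ?D) (at t)"
    by (rule has_derivative_compose)
  moreover have "x + t *\<^sub>R v + (s - t) *\<^sub>R v = x + s *\<^sub>R v" for s
    by (simp add: scaleR_left_diff_distrib)
  ultimately show ?thesis
    by (simp only: has_vector_derivative_def)
qed

text \<open>Two applications of the mean value theorem, first along \<open>v\<close> to the difference of \<open>u\<close> across
  the parallelogram and then along \<open>w\<close> to \<open>p\<close>. The second difference is symmetric in \<open>v\<close>
  and \<open>w\<close>, so that both orders of differentiation can be read off from the same number.\<close>

lemma second_difference_mean_value:
  fixes u :: "'a::real_normed_vector \<Rightarrow> real"
  assumes "0 < s"
    and p: "\<And>x. x \<in> S \<Longrightarrow> ((\<lambda>t. u (x + t *\<^sub>R v)) has_vector_derivative p x) (at 0)"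
    and q: "\<And>x. x \<in> S \<Longrightarrow> ((\<lambda>t. p (x + t *\<^sub>R w)) has_vector_derivative q x) (at 0)"
    and S: "\<And>a b. \<lbrakk>0 \<le> a; a \<le> s; 0 \<le> b; b \<le> s\<rbrakk> \<Longrightarrow> z + a *\<^sub>R v + b *\<^sub>R w \<in> S"
  obtains a b where "0 < a" "a < s" "0 < b" "b < s"
    "u (z + s *\<^sub>R v + s *\<^sub>R w) - u (z + s *\<^sub>R v) - u (z + s *\<^sub>R w) + u z
       = s\<^sup>2 * q (z + a *\<^sub>R v + b *\<^sub>R w)"
proof -
  define g where "g t = u ((z + s *\<^sub>R w) + t *\<^sub>R v) - u (z + t *\<^sub>R v)" for t
  have g: "(g has_real_derivative p (z + s *\<^sub>R w + t *\<^sub>R v) - p (z + t *\<^sub>R v)) (at t)"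
    if "0 \<le> t" "t \<le> s" for t
  proof -
    have "z + s *\<^sub>R w + t *\<^sub>R v \<in> S" "z + t *\<^sub>R v \<in> S"
      using S[of t s] S[of t 0] that \<open>0 < s\<close> by (auto simp: algebra_simps)
    then show ?thesis
      unfolding g_def has_real_derivative_iff_has_vector_derivative
      by (intro has_vector_derivative_diff directional_derivative_along_line[OF p])
  qed
  then obtain a where a: "0 < a" "a < s"
      "g s - g 0 = (s - 0) * (p (z + s *\<^sub>R w + a *\<^sub>R v) - p (z + a *\<^sub>R v))"
    using MVT2[OF \<open>0 < s\<close>, of g "\<lambda>t. p (z + s *\<^sub>R w + t *\<^sub>R v) - p (z + t *\<^sub>R v)"] by auto
  have k: "((\<lambda>t. p (z + a *\<^sub>R v + t *\<^sub>R w)) has_real_derivative q (z + a *\<^sub>R v + t *\<^sub>R w)) (at t)"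
    if "0 \<le> t" "t \<le> s" for t
    unfolding has_real_derivative_iff_has_vector_derivative
    using S[of a t] a that by (intro directional_derivative_along_line[OF q]) simp_all
  then obtain b where b: "0 < b" "b < s"
      "p (z + a *\<^sub>R v + s *\<^sub>R w) - p (z + a *\<^sub>R v + 0 *\<^sub>R w) = (s - 0) * q (z + a *\<^sub>R v + b *\<^sub>R w)"
    using MVT2[OF \<open>0 < s\<close>, of "\<lambda>t. p (z + a *\<^sub>R v + t *\<^sub>R w)" "\<lambda>t. q (z + a *\<^sub>R v + t *\<^sub>R w)"] by auto
  show thesis
  proof (rule that[OF a(1,2) b(1,2)])
    have "u (z + s *\<^sub>R v + s *\<^sub>R w) - u (z + s *\<^sub>R v) - u (z + s *\<^sub>R w) + u z = g s - g 0"
      by (simp add: g_def algebra_simps)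
    also have "\<dots> = s * (p (z + a *\<^sub>R v + s *\<^sub>R w) - p (z + a *\<^sub>R v))"
      using a(3) by (simp add: algebra_simps)
    also have "\<dots> = s\<^sup>2 * q (z + a *\<^sub>R v + b *\<^sub>R w)"
      using b(3) by (simp add: power2_eq_square)
    finally show "u (z + s *\<^sub>R v + s *\<^sub>R w) - u (z + s *\<^sub>R v) - u (z + s *\<^sub>R w) + u z
       = s\<^sup>2 * q (z + a *\<^sub>R v + b *\<^sub>R w)" .
  qed
qed

text \<open>On a small parallelogram at \<open>z\<close> the second difference equals its area factor times a value of
  \<open>pq\<close>, and also times a value of \<open>qp\<close>, both taken near \<open>z\<close>; continuity at \<open>z\<close> forces the
  two values to agree there.\<close>

lemma mixed_directional_derivatives_commute:
  fixes u :: "'a::real_normed_vector \<Rightarrow> real"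
  assumes S: "open S" "z \<in> S"
    and p: "\<And>x. x \<in> S \<Longrightarrow> ((\<lambda>t. u (x + t *\<^sub>R v)) has_vector_derivative p x) (at 0)"
    and q: "\<And>x. x \<in> S \<Longrightarrow> ((\<lambda>t. u (x + t *\<^sub>R w)) has_vector_derivative q x) (at 0)"
    and pq: "\<And>x. x \<in> S \<Longrightarrow> ((\<lambda>t. p (x + t *\<^sub>R w)) has_vector_derivative pq x) (at 0)"
    and qp: "\<And>x. x \<in> S \<Longrightarrow> ((\<lambda>t. q (x + t *\<^sub>R v)) has_vector_derivative qp x) (at 0)"
    and cont: "continuous_on S pq" "continuous_on S qp"
  shows "pq z = qp z"
proof -
  have "\<bar>pq z - qp z\<bar> \<le> 0 + e" if "0 < e" for e
  proof -
    have "pq \<midarrow>z\<rightarrow> pq z" "qp \<midarrow>z\<rightarrow> qp z"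
      using cont S by (auto simp: continuous_on_eq_continuous_at isCont_def)
    from tendstoD[OF this(1), of "e/2"] tendstoD[OF this(2), of "e/2"] \<open>0 < e\<close>
    have "\<forall>\<^sub>F x in at z. dist (pq x) (pq z) < e/2 \<and> dist (qp x) (qp z) < e/2 \<and> x \<in> S"
      by (intro eventually_conj eventually_at_in_open' S) simp_all
    then obtain d where "0 < d" and d': "\<And>x. x \<noteq> z \<Longrightarrow> dist x z < d \<Longrightarrow>
        dist (pq x) (pq z) < e/2 \<and> dist (qp x) (qp z) < e/2 \<and> x \<in> S"
      unfolding eventually_at by blast
    have d: "dist (pq x) (pq z) < e/2 \<and> dist (qp x) (qp z) < e/2 \<and> x \<in> S" if "dist x z < d" for x
    proof (cases "x = z")
      case True
      then show ?thesis using S \<open>0 < e\<close> by simp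
    next
      case False
      then show ?thesis using d' that by blast
    qed
    \<comment> \<open>The side length \<open>s\<close> is so small that the whole parallelogram stays within distance \<open>d\<close> of \<open>z\<close>.\<close>
    define s where "s = d / (2 * (norm v + norm w + 1))"
    have "0 < s" unfolding s_def using \<open>0 < d\<close> by (intro divide_pos_pos mult_pos_pos add_nonneg_pos) simp_all
    have near: "dist (z + a *\<^sub>R v + b *\<^sub>R w) z < d" if "0 \<le> a" "a \<le> s" "0 \<le> b" "b \<le> s" for a b
    proof -
      have "dist (z + a *\<^sub>R v + b *\<^sub>R w) z \<le> a * norm v + b * norm w"
        using norm_triangle_ineq[of "a *\<^sub>R v" "b *\<^sub>R w"] that by (simp add: dist_norm)
      also have "\<dots> \<le> s * norm v + s * norm w"
        by (intro add_mono mult_right_mono that) auto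
      also have "\<dots> \<le> s * (norm v + norm w + 1)"
        using \<open>0 < s\<close> by (simp add: algebra_simps)
      also have "\<dots> = d / 2"
      proof -
        have "norm v + norm w + 1 > 0" by (intro add_nonneg_pos) auto
        then have nz: "norm v + norm w + 1 \<noteq> 0" by linarith
        have "d / (2 * c) * c = d / 2" if "c \<noteq> 0" for c :: real using that by simp
        from this[OF nz] show ?thesis by (simp only: s_def)
      qed
      finally show ?thesis using \<open>0 < d\<close> by simp
    qed
    obtain a b where ab: "0 < a" "a < s" "0 < b" "b < s"
      "u (z + s *\<^sub>R v + s *\<^sub>R w) - u (z + s *\<^sub>R v) - u (z + s *\<^sub>R w) + u z
         = s\<^sup>2 * pq (z + a *\<^sub>R v + b *\<^sub>R w)"
    proof (rule second_difference_mean_value[OF \<open>0 < s\<close> p pq])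
      fix a b assume "0 \<le> a" "a \<le> s" "0 \<le> b" "b \<le> s"
      then show "z + a *\<^sub>R v + b *\<^sub>R w \<in> S" using d[OF near] by blast
    qed
    obtain a' b' where ab': "0 < a'" "a' < s" "0 < b'" "b' < s"
      "u (z + s *\<^sub>R w + s *\<^sub>R v) - u (z + s *\<^sub>R w) - u (z + s *\<^sub>R v) + u z
         = s\<^sup>2 * qp (z + a' *\<^sub>R w + b' *\<^sub>R v)"
    proof (rule second_difference_mean_value[OF \<open>0 < s\<close> q qp])
      fix a b assume "0 \<le> a" "a \<le> s" "0 \<le> b" "b \<le> s"
      then have "z + b *\<^sub>R v + a *\<^sub>R w \<in> S" using d[OF near] by blast
      then show "z + a *\<^sub>R w + b *\<^sub>R v \<in> S" by (simp add: add_ac)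
    qed
    have "s\<^sup>2 * pq (z + a *\<^sub>R v + b *\<^sub>R w) = s\<^sup>2 * qp (z + a' *\<^sub>R w + b' *\<^sub>R v)"
      unfolding ab(5)[symmetric] ab'(5)[symmetric] by (simp add: add_ac)
    then have "pq (z + a *\<^sub>R v + b *\<^sub>R w) = qp (z + a' *\<^sub>R w + b' *\<^sub>R v)"
      using \<open>0 < s\<close> by simp
    also have "\<dots> = qp (z + b' *\<^sub>R v + a' *\<^sub>R w)"
      by (simp add: add_ac)
    finally have eq: "pq (z + a *\<^sub>R v + b *\<^sub>R w) = qp (z + b' *\<^sub>R v + a' *\<^sub>R w)" .
    have "dist (pq (z + a *\<^sub>R v + b *\<^sub>R w)) (pq z) < e/2"
      using d[OF near[of a b]] ab(1-4) by simp
    moreover have "dist (qp (z + b' *\<^sub>R v + a' *\<^sub>R w)) (qp z) < e/2"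
      using d[OF near[of b' a']] ab'(1-4) by simp
    ultimately have "dist (pq z) (qp z) < e"
      unfolding eq by (rule dist_triangle_half_r)
    then show ?thesis by (simp add: dist_real_def)
  qed
  then have "\<bar>pq z - qp z\<bar> \<le> 0" by (rule field_le_epsilon)
  then show ?thesis by simp
qed


section \<open>Harmonic functions of one complex variable\<close>

lemma has_derivative_imp_directional:
  assumes "(u has_derivative u') (at z)"
  shows "((\<lambda>t. u (z + t *\<^sub>R v)) has_vector_derivative u' v) (at 0)"
proof -
  interpret bounded_linear u' by (rule has_derivative_bounded_linear[OF assms])
  have "((\<lambda>t. u (z + t *\<^sub>R v)) has_derivative (\<lambda>t. u' (t *\<^sub>R v))) (at 0)"
    by (rule has_derivative_compose[of "\<lambda>t. z + t *\<^sub>R v"]) (use assms in \<open>auto intro!: derivative_eq_intros\<close>)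
  then show ?thesis by (simp add: has_vector_derivative_def scaleR)
qed

lemma differentiable_complex_has_derivative:
  fixes u :: "complex \<Rightarrow> 'b::real_normed_vector"
  assumes "u differentiable (at z)"
  shows "(u has_derivative (\<lambda>h. Re h *\<^sub>R deriv_dir 1 u z + Im h *\<^sub>R deriv_dir \<i> u z)) (at z)"
proof -
  let ?D = "frechet_derivative u (at z)"
  have D: "(u has_derivative ?D) (at z)" using assms frechet_derivative_works by blast
  interpret bounded_linear ?D by (rule has_derivative_bounded_linear[OF D])
  have "?D h = Re h *\<^sub>R deriv_dir 1 u z + Im h *\<^sub>R deriv_dir \<i> u z" for h
  proof -
    have "h = Re h *\<^sub>R 1 + Im h *\<^sub>R \<i>" by (simp add: complex_eq_iff)
    then have "?D h = ?D (Re h *\<^sub>R 1 + Im h *\<^sub>R \<i>)" by simp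
    also have "\<dots> = Re h *\<^sub>R ?D 1 + Im h *\<^sub>R ?D \<i>" by (simp only: add scaleR)
    finally show ?thesis by (simp add: deriv_dir_def)
  qed
  then have "?D = (\<lambda>h. Re h *\<^sub>R deriv_dir 1 u z + Im h *\<^sub>R deriv_dir \<i> u z)" by (rule ext)
  then show ?thesis using D by metis
qed

text \<open>The function \<open>\<partial>u = (u\<^sub>x - \<i> u\<^sub>y) / 2\<close> satisfies the Cauchy-Riemann equations: this is the
  Laplace equation together with \<open>u\<^sub>x\<^sub>y = u\<^sub>y\<^sub>x\<close>. Its primitive \<open>F\<close> on the convex set \<open>S\<close> absorbs
  the complex-linear part of the derivative of \<open>u\<close>, so \<open>u - F\<close> has a conjugate-linear
  derivative and its conjugate is holomorphic.\<close>

lemma harmonic_on_convex_decomposition: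
  fixes u :: "complex \<Rightarrow> complex"
  assumes S: "open S" "convex S" and harm: "harmonic_on u S"
  obtains F G where "F holomorphic_on S" "G holomorphic_on S" "\<And>z. z \<in> S \<Longrightarrow> u z = F z + cnj (G z)"
proof -
  define p where "p = deriv_dir 1 u"
  define q where "q = deriv_dir \<i> u"
  define pp where "pp = deriv_dir 1 p"
  define pq where "pq = deriv_dir \<i> p"
  define qp where "qp = deriv_dir 1 q"
  define qq where "qq = deriv_dir \<i> q"
  note defs = p_def q_def pp_def pq_def qp_def qq_def
  have u: "(u has_derivative (\<lambda>h. Re h *\<^sub>R p z + Im h *\<^sub>R q z)) (at z)"
    and p: "(p has_derivative (\<lambda>h. Re h *\<^sub>R pp z + Im h *\<^sub>R pq z)) (at z)"
    and q: "(q has_derivative (\<lambda>h. Re h *\<^sub>R qp z + Im h *\<^sub>R qq z)) (at z)"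
    and lap: "pp z + qq z = 0"
    if "z \<in> S" for z
    using harm that unfolding harmonic_on_def C2_on_def C1_on_def laplacian_def defs
    by (auto intro!: differentiable_complex_has_derivative simp: Basis_complex_def)
  have cont: "continuous_on S pq" "continuous_on S qp"
    using harm unfolding harmonic_on_def C2_on_def C1_on_def defs by (auto simp: Basis_complex_def)
  have mixed: "pq z = qp z" if "z \<in> S" for z
  proof -
    \<comment> \<open>The mean value theorem needs real values, so the real and imaginary parts are treated apart.\<close>
    have "L (pq z) = L (qp z)" if L: "bounded_linear L" for L :: "complex \<Rightarrow> real"
    proof (rule mixed_directional_derivatives_commute[where u = "\<lambda>x. L (u x)" and p = "\<lambda>x. L (p x)"
            and q = "\<lambda>x. L (q x)" and v = 1 and w = \<i>, OF S(1) \<open>z \<in> S\<close>])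
      show "continuous_on S (\<lambda>x. L (pq x))" "continuous_on S (\<lambda>x. L (qp x))"
        using cont L by (auto intro: bounded_linear.continuous_on)
    qed (use has_derivative_imp_directional[OF u, of _ 1] has_derivative_imp_directional[OF u, of _ \<i>]
            has_derivative_imp_directional[OF p, of _ \<i>] has_derivative_imp_directional[OF q, of _ 1]
         in \<open>auto intro!: bounded_linear.has_vector_derivative[OF L]\<close>)
    from this[OF bounded_linear_Re] this[OF bounded_linear_Im] show ?thesis
      by (simp add: complex_eq_iff)
  qed
  have "((\<lambda>z. (p z - \<i> * q z) / 2) has_field_derivative (pp z - \<i> * pq z) / 2) (at z)" if "z \<in> S" for z
  proof -
    have D: "((\<lambda>z. (p z - \<i> * q z) / 2) has_derivative
        (\<lambda>h. ((Re h *\<^sub>R pp z + Im h *\<^sub>R pq z) - \<i> * (Re h *\<^sub>R qp z + Im h *\<^sub>R qq z)) / 2)) (at z)"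
      using p[OF that] q[OF that]
      by (intro bounded_linear.has_derivative[OF bounded_linear_divide]
          has_derivative_diff bounded_linear.has_derivative[OF bounded_linear_mult_right])
    have eq: "((Re h *\<^sub>R pp z + Im h *\<^sub>R pq z) - \<i> * (Re h *\<^sub>R qp z + Im h *\<^sub>R qq z)) / 2
        = (pp z - \<i> * pq z) / 2 * h" for h
    proof -
      have "qq z = - pp z" using lap[OF that] by (simp add: eq_neg_iff_add_eq_0 add.commute)
      then show ?thesis using mixed[OF that]
        by (simp add: complex_eq_iff) (simp add: field_simps)
    qed
    show ?thesis unfolding has_field_derivative_def
      by (rule has_derivative_eq_rhs[OF D ext[OF eq]])
  qed
  then have hol: "(\<lambda>z. (p z - \<i> * q z) / 2) holomorphic_on S"
    unfolding holomorphic_on_open[OF S(1)] by blast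
  obtain F where "\<And>z. z \<in> S \<Longrightarrow> (F has_field_derivative (p z - \<i> * q z) / 2) (at z within S)"
    using holomorphic_convex_primitive'[OF S(2) S(1) hol] by blast
  then have F: "\<And>z. z \<in> S \<Longrightarrow> (F has_field_derivative (p z - \<i> * q z) / 2) (at z)"
    using at_within_open[OF _ S(1)] by simp
  have G: "((\<lambda>z. cnj (u z - F z)) has_field_derivative cnj ((p z + \<i> * q z) / 2)) (at z)" if "z \<in> S" for z
  proof -
    have D: "((\<lambda>z. cnj (u z - F z)) has_derivative
       (\<lambda>h. cnj ((Re h *\<^sub>R p z + Im h *\<^sub>R q z) - (p z - \<i> * q z) / 2 * h))) (at z)"
      using u[OF that] F[OF that]
      unfolding has_field_derivative_def
      by (intro bounded_linear.has_derivative[OF bounded_linear_cnj] has_derivative_diff)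
    have eq: "cnj ((Re h *\<^sub>R p z + Im h *\<^sub>R q z) - (p z - \<i> * q z) / 2 * h)
        = cnj ((p z + \<i> * q z) / 2) * h" for h
      by (simp add: complex_eq_iff) (simp add: field_simps)
    show ?thesis unfolding has_field_derivative_def
      by (rule has_derivative_eq_rhs[OF D ext[OF eq]])
  qed
  show thesis
  proof (rule that[of F "\<lambda>z. cnj (u z - F z)"])
    show "F holomorphic_on S" using F unfolding holomorphic_on_open[OF S(1)] by blast
    show "(\<lambda>z. cnj (u z - F z)) holomorphic_on S" using G unfolding holomorphic_on_open[OF S(1)] by blast
  qed auto
qed

section \<open>The Schwarz lemma for harmonic maps\<close>

text \<open>The tangent maps the strip \<open>\<bar>Re w\<bar> < \<pi>/4\<close> into the unit disc. With \<open>k = sinh\<^sup>2 (Im w)\<close> and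
  \<open>a = \<bar>Re w\<bar>\<close> one has \<open>\<bar>tan w\<bar>\<^sup>2 = (sin\<^sup>2 a + k) / (cos\<^sup>2 a + k)\<close>; since \<open>sin a < cos a\<close>, this
  fraction lies below 1 and increases with \<open>k\<close>, hence is at least \<open>tan\<^sup>2 a \<ge> a\<^sup>2\<close>.\<close>

lemma tan_strip:
  fixes w :: complex
  assumes "\<bar>Re w\<bar> < pi / 4"
  shows "cos w \<noteq> 0" "norm (tan w) < 1" "\<bar>Re w\<bar> \<le> norm (tan w)"
proof -
  define a where "a = \<bar>Re w\<bar>"
  define k where "k = ((exp (Im w) - inverse (exp (Im w))) / 2)\<^sup>2"
  have a: "0 \<le> a" "a < pi / 4" using assms by (auto simp: a_def)
  have cosa: "cos (Re w) = cos a" and sina: "(sin (Re w))\<^sup>2 = (sin a)\<^sup>2"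
    by (auto simp: a_def abs_if)
  have c: "(norm (cos w))\<^sup>2 = (cos a)\<^sup>2 + k"
    unfolding norm_cos_squared k_def cosa by (simp add: power_divide)
  have s: "(norm (sin w))\<^sup>2 = (sin a)\<^sup>2 + k"
  proof -
    have "exp (2 * Im w) = (exp (Im w))\<^sup>2" by (simp add: exp_double)
    moreover have "cos (2 * Re w) = 1 - 2 * (sin a)\<^sup>2" using cos_double_sin[of "Re w"] sina by simp
    ultimately show ?thesis
      unfolding norm_sin_squared k_def
      by (simp add: power_divide power2_diff power_inverse)
  qed
  have "k \<ge> 0" by (simp add: k_def)
  have pos: "0 < cos a" using a pi_gt_zero by (intro cos_gt_zero_pi) linarith+
  have "0 \<le> sin a" using a pi_gt_zero by (intro sin_ge_zero) linarith+
  have "tan a < 1"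
    using tan_monotone[of a "pi / 4"] a pi_gt_zero by (simp add: tan_45)
  then have less: "sin a < cos a" using pos by (simp add: tan_def)
  then have sq: "(sin a)\<^sup>2 < (cos a)\<^sup>2" using \<open>0 \<le> sin a\<close> by (simp add: power_strict_mono)
  have cw: "(norm (cos w))\<^sup>2 > 0" using c pos \<open>k \<ge> 0\<close> by (simp add: add_pos_nonneg)
  then show "cos w \<noteq> 0" by auto
  have t: "(norm (tan w))\<^sup>2 = ((sin a)\<^sup>2 + k) / ((cos a)\<^sup>2 + k)"
    by (simp add: tan_def norm_divide power_divide c s)
  have "(norm (tan w))\<^sup>2 < 1\<^sup>2" using t sq c cw by simp
  then show "norm (tan w) < 1" by (rule power_less_imp_less_base) simp
  have "(tan a)\<^sup>2 \<le> (norm (tan w))\<^sup>2"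
  proof -
    have "(sin a)\<^sup>2 * k \<le> (cos a)\<^sup>2 * k" using sq \<open>k \<ge> 0\<close> by (intro mult_right_mono) auto
    then have "(sin a)\<^sup>2 * ((cos a)\<^sup>2 + k) \<le> ((sin a)\<^sup>2 + k) * (cos a)\<^sup>2"
      by (simp add: algebra_simps)
    then show ?thesis unfolding t using pos cw c
      by (simp add: tan_def power_divide frac_le_eq divide_le_eq pos_le_divide_eq)
  qed
  then have "tan a \<le> norm (tan w)" by (rule power2_le_imp_le) simp
  moreover have "a \<le> tan a"
  proof (cases "a = 0")
    case False
    have "DERIV tan x :> inverse ((cos x)\<^sup>2)" if "0 \<le> x" "x \<le> a" for x
      using that a cos_gt_zero_pi[of x] by (intro DERIV_tan) auto
    then obtain c where c: "0 < c" "c < a" "tan a - tan 0 = (a - 0) * inverse ((cos c)\<^sup>2)"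
      using MVT2[of 0 a tan "\<lambda>x. inverse ((cos x)\<^sup>2)"] a False by auto
    have "0 < cos c" using c a pi_gt_zero by (intro cos_gt_zero_pi) linarith+
    then have "1 \<le> inverse ((cos c)\<^sup>2)"
      by (intro one_le_inverse) (auto simp: power_le_one)
    then have "a * 1 \<le> a * inverse ((cos c)\<^sup>2)" using a by (intro mult_left_mono) auto
    then show ?thesis using c by simp
  qed simp
  ultimately show "\<bar>Re w\<bar> \<le> norm (tan w)" by (simp add: a_def)
qed

text \<open>Harmonicity on a disc about 0 of a map into a real inner product space, tested against real
  functionals. Requiring a holomorphic function rather than second derivatives makes the notion
  visibly stable under linear operations, such as the difference quotients used below, and puts
  it into the form to which the classical Schwarz lemma applies.\<close>

definition weakly_harmonic_disc :: "(complex \<Rightarrow> 'a::real_inner) \<Rightarrow> real \<Rightarrow> bool" where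
  "weakly_harmonic_disc U r \<longleftrightarrow>
     (\<forall>a. \<exists>H. H holomorphic_on ball 0 r \<and> (\<forall>\<zeta>\<in>ball 0 r. a \<bullet> U \<zeta> = Re (H \<zeta>)))"

lemma weakly_harmonic_disc_const: "weakly_harmonic_disc (\<lambda>\<zeta>. c) r"
  unfolding weakly_harmonic_disc_def
proof
  fix a
  show "\<exists>H. H holomorphic_on ball 0 r \<and> (\<forall>\<zeta>\<in>ball 0 r. a \<bullet> c = Re (H \<zeta>))"
    by (intro exI[of _ "\<lambda>\<zeta>. of_real (a \<bullet> c)"]) simp
qed

lemma weakly_harmonic_disc_diff:
  assumes "weakly_harmonic_disc U r" "weakly_harmonic_disc V r"
  shows "weakly_harmonic_disc (\<lambda>\<zeta>. U \<zeta> - V \<zeta>) r"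
  unfolding weakly_harmonic_disc_def
proof
  fix a
  obtain H where H: "H holomorphic_on ball 0 r" "\<And>\<zeta>. \<zeta> \<in> ball 0 r \<Longrightarrow> a \<bullet> U \<zeta> = Re (H \<zeta>)"
    using assms(1) unfolding weakly_harmonic_disc_def by meson
  obtain J where J: "J holomorphic_on ball 0 r" "\<And>\<zeta>. \<zeta> \<in> ball 0 r \<Longrightarrow> a \<bullet> V \<zeta> = Re (J \<zeta>)"
    using assms(2) unfolding weakly_harmonic_disc_def by meson
  show "\<exists>H. H holomorphic_on ball 0 r \<and> (\<forall>\<zeta>\<in>ball 0 r. a \<bullet> (U \<zeta> - V \<zeta>) = Re (H \<zeta>))"
    using H J by (intro exI[of _ "\<lambda>\<zeta>. H \<zeta> - J \<zeta>"]) (simp add: holomorphic_on_diff inner_diff_right)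
qed

lemma weakly_harmonic_disc_scaleR:
  assumes "weakly_harmonic_disc U r"
  shows "weakly_harmonic_disc (\<lambda>\<zeta>. c *\<^sub>R U \<zeta>) r"
  unfolding weakly_harmonic_disc_def
proof
  fix a
  obtain H where H: "H holomorphic_on ball 0 r" "\<And>\<zeta>. \<zeta> \<in> ball 0 r \<Longrightarrow> (c *\<^sub>R a) \<bullet> U \<zeta> = Re (H \<zeta>)"
    using assms(1) unfolding weakly_harmonic_disc_def by meson
  then show "\<exists>H. H holomorphic_on ball 0 r \<and> (\<forall>\<zeta>\<in>ball 0 r. a \<bullet> (c *\<^sub>R U \<zeta>) = Re (H \<zeta>))"
    by (intro exI[of _ H]) simp
qed

lemma weakly_harmonic_disc_mono:
  assumes "weakly_harmonic_disc U r" "s \<le> r"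
  shows "weakly_harmonic_disc U s"
  unfolding weakly_harmonic_disc_def
proof
  fix a
  obtain H where H: "H holomorphic_on ball 0 r" "\<And>\<zeta>. \<zeta> \<in> ball 0 r \<Longrightarrow> a \<bullet> U \<zeta> = Re (H \<zeta>)"
    using assms(1) unfolding weakly_harmonic_disc_def by meson
  have "ball 0 s \<subseteq> ball (0::complex) r" using \<open>s \<le> r\<close> by auto
  then show "\<exists>H. H holomorphic_on ball 0 s \<and> (\<forall>\<zeta>\<in>ball 0 s. a \<bullet> U \<zeta> = Re (H \<zeta>))"
    using H by (meson holomorphic_on_subset subsetD)
qed

lemma weakly_harmonic_disc_differentiable:
  fixes U :: "complex \<Rightarrow> 'a::euclidean_space"
  assumes U: "weakly_harmonic_disc U r" and \<zeta>: "\<zeta> \<in> ball 0 r"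
  shows "U differentiable (at \<zeta>)"
proof -
  have "(\<lambda>x. U x \<bullet> i) differentiable (at \<zeta>)" for i
  proof -
    obtain H where H: "H holomorphic_on ball 0 r" "\<And>\<zeta>. \<zeta> \<in> ball 0 r \<Longrightarrow> i \<bullet> U \<zeta> = Re (H \<zeta>)"
      using U unfolding weakly_harmonic_disc_def by meson
    obtain D where "(H has_field_derivative D) (at \<zeta>)"
      using H(1) \<zeta> unfolding holomorphic_on_open[OF open_ball] by blast
    then have "((\<lambda>x. Re (H x)) has_derivative (\<lambda>h. Re (D * h))) (at \<zeta>)"
      unfolding has_field_derivative_def by (rule bounded_linear.has_derivative[OF bounded_linear_Re])
    then have "((\<lambda>x. U x \<bullet> i) has_derivative (\<lambda>h. Re (D * h))) (at \<zeta>)"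
      by (rule has_derivative_transform_within_open[OF _ open_ball \<zeta>]) (simp add: H(2) inner_commute)
    then show ?thesis by (rule differentiableI)
  qed
  then show ?thesis by (subst differentiable_componentwise_within) simp
qed

text \<open>After rescaling, \<open>H\<close> maps the unit disc into the strip \<open>\<bar>Re w\<bar> < \<pi>/4\<close>, which the tangent
  carries into the unit disc, fixing 0. The Schwarz lemma for the composition bounds the
  tangent, and with it the real part. This is where the constant \<open>4/\<pi>\<close> comes from.\<close>

lemma holomorphic_Re_Schwarz:
  assumes H: "H holomorphic_on ball 0 r" "H 0 = 0" and "0 < r"
    and M: "\<And>\<zeta>. \<zeta> \<in> ball 0 r \<Longrightarrow> \<bar>Re (H \<zeta>)\<bar> < M" and \<zeta>: "\<zeta> \<in> ball 0 r"
  shows "\<bar>Re (H \<zeta>)\<bar> \<le> 4 * M / (pi * r) * norm \<zeta>"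
proof -
  have "0 < M" using M[of 0] \<open>0 < r\<close> by simp
  define c where "c = pi / (4 * M)"
  have "0 < c" using \<open>0 < M\<close> by (simp add: c_def)
  define k where "k w = of_real c * H (of_real r * w)" for w
  have rw: "of_real r * w \<in> ball 0 r" if "norm w < 1" for w :: complex
    using that \<open>0 < r\<close> by (simp add: norm_mult)
  have strip: "\<bar>Re (k w)\<bar> < pi / 4" if "norm w < 1" for w
  proof -
    have "\<bar>Re (k w)\<bar> = c * \<bar>Re (H (of_real r * w))\<bar>"
      using \<open>0 < c\<close> by (simp add: k_def abs_mult)
    also have "\<dots> < c * M" using M[OF rw[OF that]] \<open>0 < c\<close> by simp
    finally show ?thesis using \<open>0 < M\<close> by (simp add: c_def)
  qed
  have "(H \<circ> (\<lambda>w. of_real r * w)) holomorphic_on ball 0 1"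
    by (rule holomorphic_on_compose_gen[OF _ H(1)]) (auto intro!: holomorphic_intros rw)
  then have "k holomorphic_on ball 0 1"
    unfolding k_def o_def by (intro holomorphic_intros)
  then have "(\<lambda>w. sin (k w) / cos (k w)) holomorphic_on ball 0 1"
    using tan_strip(1)[OF strip] by (intro holomorphic_intros) simp_all
  then have hol: "(\<lambda>w. tan (k w)) holomorphic_on ball 0 1"
    by (simp add: tan_def)
  have z: "norm (\<zeta> / of_real r) < 1" using \<zeta> \<open>0 < r\<close> by (simp add: norm_divide)
  have kz: "k (\<zeta> / of_real r) = of_real c * H \<zeta>"
    using \<open>0 < r\<close> by (simp add: k_def)
  have "c * \<bar>Re (H \<zeta>)\<bar> = \<bar>Re (k (\<zeta> / of_real r))\<bar>"
    using \<open>0 < c\<close> by (simp add: kz abs_mult)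
  also have "\<dots> \<le> norm (tan (k (\<zeta> / of_real r)))"
    by (rule tan_strip(3)[OF strip[OF z]])
  also have "\<dots> \<le> norm (\<zeta> / of_real r)"
  proof (rule Schwarz_Lemma(1)[OF hol _ _ z])
    show "tan (k 0) = 0" by (simp add: k_def H(2))
    show "norm (tan (k w)) < 1" if "norm w < 1" for w by (rule tan_strip(2)[OF strip[OF that]])
  qed
  also have "\<dots> = norm \<zeta> / r" using \<open>0 < r\<close> by (simp add: norm_divide)
  finally have "\<bar>Re (H \<zeta>)\<bar> \<le> norm \<zeta> / r / c"
    using \<open>0 < c\<close> by (subst pos_le_divide_eq) (simp_all add: mult.commute)
  also have "\<dots> = 4 * M / (pi * r) * norm \<zeta>"
    by (simp add: c_def mult_ac)
  finally show ?thesis .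
qed

text \<open>For a given \<open>\<zeta>\<close> it suffices to test \<open>U\<close> against the unit vector in the direction of \<open>U \<zeta>\<close>.
  Thus the constant is that of real harmonic functions, whatever the dimension of the target.\<close>

lemma weakly_harmonic_Schwarz:
  fixes U :: "complex \<Rightarrow> 'a::real_inner"
  assumes U: "weakly_harmonic_disc U r" "U 0 = 0" and "0 < r"
    and M: "\<And>\<zeta>. \<zeta> \<in> ball 0 r \<Longrightarrow> norm (U \<zeta>) \<le> M" and \<zeta>: "\<zeta> \<in> ball 0 r"
  shows "norm (U \<zeta>) \<le> 4 * M / (pi * r) * norm \<zeta>"
proof -
  define a where "a = sgn (U \<zeta>)"
  have a: "norm a \<le> 1" "a \<bullet> U \<zeta> = norm (U \<zeta>)"
    by (cases "U \<zeta> = 0"; simp add: a_def norm_sgn sgn_div_norm dot_square_norm power2_eq_square)+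
  obtain H where H: "H holomorphic_on ball 0 r" "\<And>\<zeta>. \<zeta> \<in> ball 0 r \<Longrightarrow> a \<bullet> U \<zeta> = Re (H \<zeta>)"
    using U unfolding weakly_harmonic_disc_def by meson
  have ReH0: "Re (H 0) = 0" using H(2)[of 0] U \<open>0 < r\<close> by simp
  \<comment> \<open>The scalar lemma needs a strict bound, hence every \<open>M' > M\<close> first and then \<open>M' \<rightarrow> M\<close>.\<close>
  have "norm (U \<zeta>) \<le> 4 * M' / (pi * r) * norm \<zeta>" if "M < M'" for M'
  proof -
    have "\<bar>Re (H \<zeta> - H 0)\<bar> \<le> 4 * M' / (pi * r) * norm \<zeta>"
    proof (rule holomorphic_Re_Schwarz[OF _ _ \<open>0 < r\<close> _ \<zeta>])
      show "(\<lambda>\<zeta>. H \<zeta> - H 0) holomorphic_on ball 0 r"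
        by (intro holomorphic_intros H(1))
      show "\<bar>Re (H \<zeta> - H 0)\<bar> < M'" if "\<zeta> \<in> ball 0 r" for \<zeta>
      proof -
        have "\<bar>Re (H \<zeta> - H 0)\<bar> = \<bar>a \<bullet> U \<zeta>\<bar>" using H(2)[OF that] ReH0 by simp
        also have "\<dots> \<le> norm a * norm (U \<zeta>)" by (rule Cauchy_Schwarz_ineq2)
        also have "\<dots> \<le> 1 * norm (U \<zeta>)" by (rule mult_right_mono[OF a(1)]) simp
        also have "\<dots> \<le> M" using M[OF that] by simp
        finally show ?thesis using \<open>M < M'\<close> by simp
      qed
    qed simp
    then show ?thesis using H(2)[OF \<zeta>] ReH0 a(2) by simp
  qed
  then have "\<forall>\<^sub>F M' in at_right M. norm (U \<zeta>) \<le> 4 * M' / (pi * r) * norm \<zeta>"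
    by (auto simp: eventually_at_filter)
  moreover have "((\<lambda>M'. 4 * M' / (pi * r) * norm \<zeta>) \<longlongrightarrow> 4 * M / (pi * r) * norm \<zeta>) (at_right M)"
    using \<open>0 < r\<close> by (intro tendsto_intros) simp
  ultimately show ?thesis
    by (intro tendsto_lowerbound[where F = "at_right M"]) simp_all
qed

section \<open>Continuous directional derivatives and differentiability\<close>

lemma has_vector_derivative_quotient_tendsto:
  assumes "(g has_vector_derivative v) (at 0)"
  shows "((\<lambda>h. (g h - g 0) /\<^sub>R h) \<longlongrightarrow> v) (at 0)"
proof -
  have "(\<lambda>h. norm (g (0 + h) - g 0 - h *\<^sub>R v) / norm h) \<midarrow>0\<rightarrow> 0"
    using assms unfolding has_vector_derivative_def has_derivative_at by blast
  moreover have "\<forall>\<^sub>F h in at 0. norm (g (0 + h) - g 0 - h *\<^sub>R v) / norm h = norm ((g h - g 0) /\<^sub>R h - v)"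
    unfolding eventually_at_filter
  proof (rule always_eventually, intro allI impI)
    fix h :: real assume "h \<noteq> 0"
    then have "(g h - g 0) /\<^sub>R h - v = (g h - g 0 - h *\<^sub>R v) /\<^sub>R h"
      by (simp add: scaleR_diff_right)
    then show "norm (g (0 + h) - g 0 - h *\<^sub>R v) / norm h = norm ((g h - g 0) /\<^sub>R h - v)"
      by (simp add: divide_inverse_commute)
  qed
  ultimately have "(\<lambda>h. norm ((g h - g 0) /\<^sub>R h - v)) \<midarrow>0\<rightarrow> 0"
    by (rule Lim_transform_eventually)
  then show ?thesis
    by (simp add: tendsto_norm_zero_iff LIM_zero_iff)
qed

text \<open>Moving from \<open>w\<close> to \<open>w + h\<close> one coordinate at a time, each step leaves an error that is a
  small multiple of \<open>norm h\<close>, by the mean value inequality and the continuity of the directional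
  derivative. For the induction over the coordinates the starting point \<open>w\<close> has to vary in a
  neighbourhood of \<open>z\<close>, because later steps start away from \<open>z\<close>.\<close>

lemma has_derivative_continuous_directional_derivatives:
  fixes f :: "'a::euclidean_space \<Rightarrow> 'b::real_normed_vector"
  assumes S: "open S" "z \<in> S"
    and d: "\<And>x b. x \<in> S \<Longrightarrow> b \<in> Basis \<Longrightarrow> ((\<lambda>t. f (x + t *\<^sub>R b)) has_vector_derivative d b x) (at 0)"
    and cont: "\<And>b. b \<in> Basis \<Longrightarrow> continuous_on S (d b)"
  shows "(f has_derivative (\<lambda>h. \<Sum>b\<in>Basis. (h \<bullet> b) *\<^sub>R d b z)) (at z)"
proof -
  have one: "\<exists>\<delta>>0. \<forall>w t. dist w z < \<delta> \<and> \<bar>t\<bar> < \<delta> \<longrightarrow>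
      norm (f (w + t *\<^sub>R b) - f w - t *\<^sub>R d b z) \<le> e * \<bar>t\<bar>" if b: "b \<in> Basis" and "0 < e" for b e
  proof -
    obtain \<delta>1 where \<delta>1: "0 < \<delta>1" "ball z \<delta>1 \<subseteq> S" using S open_contains_ball by blast
    obtain \<delta>2 where \<delta>2: "0 < \<delta>2" "\<And>x. x \<in> S \<Longrightarrow> dist x z < \<delta>2 \<Longrightarrow> dist (d b x) (d b z) < e"
      using cont[OF b] S(2) \<open>0 < e\<close> unfolding continuous_on_iff by blast
    define \<delta> where "\<delta> = min \<delta>1 \<delta>2 / 2"
    have "0 < \<delta>" using \<delta>1 \<delta>2 by (simp add: \<delta>_def)
    moreover have "norm (f (w + t *\<^sub>R b) - f w - t *\<^sub>R d b z) \<le> e * \<bar>t\<bar>"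
      if w: "dist w z < \<delta>" and t: "\<bar>t\<bar> < \<delta>" for w t
    proof -
      define g where "g s = f (w + s *\<^sub>R b) - s *\<^sub>R d b z" for s
      have near: "dist (w + s *\<^sub>R b) z < min \<delta>1 \<delta>2" if "\<bar>s\<bar> < \<delta>" for s
      proof -
        have "dist (w + s *\<^sub>R b) z \<le> \<bar>s\<bar> + dist w z"
          using dist_triangle[of "w + s *\<^sub>R b" z w] b by (simp add: dist_norm)
        then show ?thesis using that w unfolding \<delta>_def by linarith
      qed
      have inS: "w + s *\<^sub>R b \<in> S" if "\<bar>s\<bar> < \<delta>" for s
        using near[OF that] \<delta>1(2) by (auto simp: dist_commute subset_iff)
      have "norm (g t - g 0) \<le> e * norm (t - 0)"
      proof (rule differentiable_bound[where S = "{-\<delta><..<\<delta>}"])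
        fix s assume "s \<in> {-\<delta><..<\<delta>}"
        then have s: "\<bar>s\<bar> < \<delta>" by auto
        have "((\<lambda>s. f (w + s *\<^sub>R b)) has_vector_derivative d b (w + s *\<^sub>R b)) (at s)"
          by (rule directional_derivative_along_line[OF d inS[OF s]]) (use b in auto)
        then have "(g has_vector_derivative d b (w + s *\<^sub>R b) - d b z) (at s)"
          unfolding g_def
          by (intro has_vector_derivative_diff) (auto intro!: derivative_eq_intros)
        then show "(g has_derivative (\<lambda>h. h *\<^sub>R (d b (w + s *\<^sub>R b) - d b z))) (at s within {-\<delta><..<\<delta>})"
          unfolding has_vector_derivative_def by (rule has_derivative_at_withinI)
        have "norm (d b (w + s *\<^sub>R b) - d b z) \<le> e"
          using \<delta>2(2)[OF inS[OF s]] near[OF s] by (simp add: dist_norm)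
        then show "onorm (\<lambda>h. h *\<^sub>R (d b (w + s *\<^sub>R b) - d b z)) \<le> e"
          using \<open>0 < e\<close>
          by (intro onorm_bound) (auto simp: mult.commute[of e] intro!: mult_left_mono)
      qed (use t \<open>0 < \<delta>\<close> in auto)
      then show ?thesis by (simp add: g_def algebra_simps)
    qed
    ultimately show ?thesis by blast
  qed
  have "\<forall>e>0. \<exists>\<delta>>0. \<forall>w h. dist w z < \<delta> \<and> norm h < \<delta> \<longrightarrow>
      norm (f (w + (\<Sum>b\<in>B. (h \<bullet> b) *\<^sub>R b)) - f w - (\<Sum>b\<in>B. (h \<bullet> b) *\<^sub>R d b z)) \<le> e * norm h"
    if "B \<subseteq> Basis" for B
    using finite_subset[OF that finite_Basis] that
  proof (induction B rule: finite_induct)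
    case empty
    show ?case by (auto intro!: exI[of _ 1])
  next
    case (insert b B)
    show ?case
    proof (intro allI impI)
      fix e :: real assume "0 < e"
      then have "0 < e/2" by simp
      have b: "b \<in> Basis" using insert by simp
      obtain \<delta>1 where \<delta>1: "0 < \<delta>1" "\<And>w t. dist w z < \<delta>1 \<Longrightarrow> \<bar>t\<bar> < \<delta>1 \<Longrightarrow>
          norm (f (w + t *\<^sub>R b) - f w - t *\<^sub>R d b z) \<le> e/2 * \<bar>t\<bar>"
        using one[OF b \<open>0 < e/2\<close>] by blast
      obtain \<delta>2 where \<delta>2: "0 < \<delta>2" "\<And>w h. dist w z < \<delta>2 \<Longrightarrow> norm h < \<delta>2 \<Longrightarrow>
          norm (f (w + (\<Sum>b\<in>B. (h \<bullet> b) *\<^sub>R b)) - f w - (\<Sum>b\<in>B. (h \<bullet> b) *\<^sub>R d b z)) \<le> e/2 * norm h"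
        using insert.IH[OF subset_trans[OF subset_insertI insert.prems], rule_format, OF \<open>0 < e/2\<close>]
        by blast
      define \<delta> where "\<delta> = min \<delta>1 (\<delta>2 / 2)"
      have "0 < \<delta>" using \<delta>1 \<delta>2 by (simp add: \<delta>_def)
      moreover have "norm (f (w + (\<Sum>b\<in>insert b B. (h \<bullet> b) *\<^sub>R b)) - f w
          - (\<Sum>b\<in>insert b B. (h \<bullet> b) *\<^sub>R d b z)) \<le> e * norm h"
        if w: "dist w z < \<delta>" and h: "norm h < \<delta>" for w h
      proof -
        define w' where "w' = w + (h \<bullet> b) *\<^sub>R b"
        have hb: "\<bar>h \<bullet> b\<bar> \<le> norm h" using b by (rule Basis_le_norm)
        have "dist w' z \<le> \<bar>h \<bullet> b\<bar> + dist w z"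
          using dist_triangle[of w' z w] b by (simp add: dist_norm w'_def)
        then have "dist w' z < \<delta>2" using hb w h unfolding \<delta>_def by linarith
        moreover have "norm h < \<delta>2" using h \<delta>2(1) unfolding \<delta>_def by linarith
        ultimately have A: "norm (f (w' + (\<Sum>b\<in>B. (h \<bullet> b) *\<^sub>R b)) - f w' - (\<Sum>b\<in>B. (h \<bullet> b) *\<^sub>R d b z))
            \<le> e/2 * norm h"
          by (rule \<delta>2(2))
        have "norm (f w' - f w - (h \<bullet> b) *\<^sub>R d b z) \<le> e/2 * \<bar>h \<bullet> b\<bar>"
          unfolding w'_def using w h hb by (intro \<delta>1(2)) (simp_all add: \<delta>_def)
        also have "\<dots> \<le> e/2 * norm h" using hb \<open>0 < e\<close> by (intro mult_left_mono) simp_all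
        finally have B: "norm (f w' - f w - (h \<bullet> b) *\<^sub>R d b z) \<le> e/2 * norm h" .
        have "w + (\<Sum>b\<in>insert b B. (h \<bullet> b) *\<^sub>R b) = w' + (\<Sum>b\<in>B. (h \<bullet> b) *\<^sub>R b)"
          using insert.hyps by (simp add: w'_def add.assoc)
        moreover have "(\<Sum>b\<in>insert b B. (h \<bullet> b) *\<^sub>R d b z) = (h \<bullet> b) *\<^sub>R d b z + (\<Sum>b\<in>B. (h \<bullet> b) *\<^sub>R d b z)"
          using insert.hyps by simp
        ultimately have split: "f (w + (\<Sum>b\<in>insert b B. (h \<bullet> b) *\<^sub>R b)) - f w
            - (\<Sum>b\<in>insert b B. (h \<bullet> b) *\<^sub>R d b z)
            = (f (w' + (\<Sum>b\<in>B. (h \<bullet> b) *\<^sub>R b)) - f w' - (\<Sum>b\<in>B. (h \<bullet> b) *\<^sub>R d b z))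
              + (f w' - f w - (h \<bullet> b) *\<^sub>R d b z)"
          by simp
        have "e/2 * norm h + e/2 * norm h = e * norm h" by simp
        then show ?thesis using norm_triangle_mono[OF A B] unfolding split by linarith
      qed
      ultimately show "\<exists>\<delta>>0. \<forall>w h. dist w z < \<delta> \<and> norm h < \<delta> \<longrightarrow>
        norm (f (w + (\<Sum>b\<in>insert b B. (h \<bullet> b) *\<^sub>R b)) - f w
          - (\<Sum>b\<in>insert b B. (h \<bullet> b) *\<^sub>R d b z)) \<le> e * norm h"
        by blast
    qed
  qed
  from this[OF order_refl] have all: "\<forall>e>0. \<exists>\<delta>>0. \<forall>w h. dist w z < \<delta> \<and> norm h < \<delta> \<longrightarrow>
      norm (f (w + h) - f w - (\<Sum>b\<in>Basis. (h \<bullet> b) *\<^sub>R d b z)) \<le> e * norm h"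
    by (simp only: euclidean_representation)
  have bl: "bounded_linear (\<lambda>h. \<Sum>b\<in>Basis. (h \<bullet> b) *\<^sub>R d b z)"
    by (intro bounded_linear_sum bounded_linear_compose[OF bounded_linear_scaleR_left bounded_linear_inner_left])
  show ?thesis
    unfolding has_derivative_at_alt
  proof (intro conjI bl allI impI)
    fix e :: real assume "0 < e"
    then obtain \<delta> where \<delta>: "0 < \<delta>" "\<And>w h. dist w z < \<delta> \<Longrightarrow> norm h < \<delta> \<Longrightarrow>
      norm (f (w + h) - f w - (\<Sum>b\<in>Basis. (h \<bullet> b) *\<^sub>R d b z)) \<le> e * norm h"
      using all[rule_format, OF \<open>0 < e\<close>] by blast
    show "\<exists>\<delta>>0. \<forall>y. norm (y - z) < \<delta> \<longrightarrow>
        norm (f y - f z - (\<Sum>b\<in>Basis. ((y - z) \<bullet> b) *\<^sub>R d b z)) \<le> e * norm (y - z)"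
    proof (intro exI conjI allI impI)
      fix y assume "norm (y - z) < \<delta>"
      then show "norm (f y - f z - (\<Sum>b\<in>Basis. ((y - z) \<bullet> b) *\<^sub>R d b z)) \<le> e * norm (y - z)"
        using \<delta>(2)[of z "y - z"] \<delta>(1) by simp
    qed (rule \<delta>(1))
  qed
qed

section \<open>Slices of pluriharmonic mappings\<close>

lemma harmonic_on_subset:
  assumes "harmonic_on u S" "T \<subseteq> S"
  shows "harmonic_on u T"
  using assms unfolding harmonic_on_def C2_on_def C1_on_def
  by (meson continuous_on_subset subsetD)

lemma ball_subset_slice_disc:
  assumes "norm z < 1"
  shows "ball 0 (1 - norm z) \<subseteq> slice_disc (ball 0 1) z"
proof
  fix \<zeta> :: complex assume "\<zeta> \<in> ball 0 (1 - norm z)"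
  then have "norm \<zeta> < 1 - norm z" by simp
  also have "1 - norm z \<le> infdist z (sphere 0 1)" if "sphere 0 1 \<noteq> ({} :: (complex^'a) set)"
  proof -
    have "1 - norm z \<le> dist z a" if "a \<in> sphere 0 1" for a
      using norm_triangle_ineq2[of a z] that by (simp add: dist_norm norm_minus_commute)
    then show ?thesis unfolding infdist_def using that by (auto intro: cINF_greatest)
  qed
  finally show "\<zeta> \<in> slice_disc (ball 0 1) z" by (simp add: slice_disc_def)
qed

lemma pluriharmonic_slice_weakly_harmonic:
  fixes f :: "complex^'n \<Rightarrow> complex^'m"
  assumes f: "pluriharmonic_mapping_on f (ball 0 1)" and z: "norm z < 1" and \<theta>: "norm \<theta> = 1"
  shows "weakly_harmonic_disc (\<lambda>\<zeta>. f (z + \<zeta> *s \<theta>)) (1 - norm z)"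
  unfolding weakly_harmonic_disc_def
proof
  fix a :: "complex^'m"
  let ?D = "ball 0 (1 - norm z) :: complex set"
  have "\<exists>F G. F holomorphic_on ?D \<and> G holomorphic_on ?D \<and>
      (\<forall>\<zeta>\<in>?D. f (z + \<zeta> *s \<theta>) $ j = F \<zeta> + cnj (G \<zeta>))" for j
  proof -
    have "harmonic_on (\<lambda>\<zeta>. f (z + \<zeta> *s \<theta>) $ j) (slice_disc (ball 0 1) z)"
      using f z \<theta> unfolding pluriharmonic_mapping_on_def pluriharmonic_on_def by simp
    then have "harmonic_on (\<lambda>\<zeta>. f (z + \<zeta> *s \<theta>) $ j) ?D"
      using ball_subset_slice_disc[OF z] by (rule harmonic_on_subset)
    then obtain F G where "F holomorphic_on ?D" "G holomorphic_on ?D"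
        "\<And>\<zeta>. \<zeta> \<in> ?D \<Longrightarrow> f (z + \<zeta> *s \<theta>) $ j = F \<zeta> + cnj (G \<zeta>)"
      using harmonic_on_convex_decomposition[OF open_ball convex_ball] by blast
    then show ?thesis by blast
  qed
  then obtain F G where F: "\<And>j. F j holomorphic_on ?D" and G: "\<And>j. G j holomorphic_on ?D"
      and FG: "\<And>j \<zeta>. \<zeta> \<in> ?D \<Longrightarrow> f (z + \<zeta> *s \<theta>) $ j = F j \<zeta> + cnj (G j \<zeta>)"
    by metis
  let ?H = "\<lambda>\<zeta>. \<Sum>j\<in>UNIV. cnj (a $ j) * F j \<zeta> + (a $ j) * G j \<zeta>"
  have "?H holomorphic_on ?D"
    by (intro holomorphic_intros F G)
  moreover have "a \<bullet> f (z + \<zeta> *s \<theta>) = Re (?H \<zeta>)" if "\<zeta> \<in> ?D" for \<zeta>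
    unfolding inner_vec_def Re_sum
    by (intro sum.cong refl) (simp add: FG[OF that] inner_complex_def algebra_simps)
  ultimately show "\<exists>H. H holomorphic_on ?D \<and> (\<forall>\<zeta>\<in>?D. a \<bullet> f (z + \<zeta> *s \<theta>) = Re (H \<zeta>))"
    by blast
qed

lemma of_real_scale_vec: "of_real t *s b = t *\<^sub>R (b :: complex^'n)"
  by (simp add: vec_eq_iff complex_eq_iff)

lemma norm_scale_vec: "norm (c *s b) = norm c * norm (b :: complex^'n)"
  by (simp add: norm_vec_def L2_set_def norm_mult power_mult_distrib sum_distrib_left[symmetric]
      real_sqrt_mult)

text \<open>Cauchy-type estimate: the difference of two parallel slices, recentred to vanish at 0, is
  harmonic and bounded by \<open>2 \<eta>\<close>, so the Schwarz lemma bounds its difference quotients at 0.\<close>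

lemma directional_derivative_le_of_slices:
  fixes f :: "complex^'n \<Rightarrow> 'a::euclidean_space"
  assumes slice: "weakly_harmonic_disc (\<lambda>\<zeta>. f (x + \<zeta> *s b)) r" "weakly_harmonic_disc (\<lambda>\<zeta>. f (y + \<zeta> *s b)) r"
    and "0 < r"
    and v: "((\<lambda>t. f (x + t *\<^sub>R b)) has_vector_derivative v) (at 0)"
    and w: "((\<lambda>t. f (y + t *\<^sub>R b)) has_vector_derivative w) (at 0)"
    and close: "\<And>\<zeta>. \<zeta> \<in> ball 0 r \<Longrightarrow> norm (f (x + \<zeta> *s b) - f (y + \<zeta> *s b)) \<le> \<eta>"
  shows "norm (v - w) \<le> 8 * \<eta> / (pi * r)"
proof -
  define W where "W \<zeta> = (f (x + \<zeta> *s b) - f (y + \<zeta> *s b)) - (f x - f y)" for \<zeta>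
  have W: "weakly_harmonic_disc W r"
    unfolding W_def by (intro weakly_harmonic_disc_diff slice weakly_harmonic_disc_const)
  have "W 0 = 0" by (simp add: W_def)
  have bound: "norm (W \<zeta>) \<le> 2 * \<eta>" if "\<zeta> \<in> ball 0 r" for \<zeta>
    using norm_triangle_ineq4[of "f (x + \<zeta> *s b) - f (y + \<zeta> *s b)" "f x - f y"]
      close[OF that] close[of 0] \<open>0 < r\<close> by (simp add: W_def)
  define g where "g t = W (of_real t)" for t
  have "(g has_vector_derivative v - w - 0) (at 0)"
    unfolding g_def W_def of_real_scale_vec
    by (intro has_vector_derivative_diff v w has_vector_derivative_const)
  then have "((\<lambda>t. norm ((g t - g 0) /\<^sub>R t)) \<longlongrightarrow> norm (v - w)) (at 0)"
    by (intro tendsto_norm) (auto dest: has_vector_derivative_quotient_tendsto)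
  moreover have "\<forall>\<^sub>F t in at 0. norm ((g t - g 0) /\<^sub>R t) \<le> 8 * \<eta> / (pi * r)"
  proof -
    have "norm ((g t - g 0) /\<^sub>R t) \<le> 8 * \<eta> / (pi * r)" if "t \<noteq> 0" "dist t 0 < r" for t
    proof -
      have "of_real t \<in> ball (0::complex) r" using that by simp
      from weakly_harmonic_Schwarz[OF W \<open>W 0 = 0\<close> \<open>0 < r\<close> bound this]
      have "norm (g t) \<le> 8 * \<eta> / (pi * r) * \<bar>t\<bar>" by (simp add: g_def)
      then show ?thesis
        using that \<open>W 0 = 0\<close> by (simp add: g_def divide_inverse_commute[symmetric] pos_divide_le_eq)
    qed
    then show ?thesis unfolding eventually_at using \<open>0 < r\<close> by blast
  qed
  ultimately show ?thesis by (rule tendsto_upperbound) (rule at_neq_bot)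
qed

text \<open>The slices only give directional derivatives at each point separately. Applying the previous
  estimate to the slices through two nearby points turns uniform continuity of \<open>f\<close> on a compact
  ball into continuity of the directional derivatives, whence \<open>f\<close> is totally differentiable.\<close>

lemma differentiable_of_harmonic_slices:
  fixes f :: "complex^'n \<Rightarrow> 'a::euclidean_space"
  assumes cont: "continuous_on (ball 0 1) f"
    and slice: "\<And>z \<theta>. norm z < 1 \<Longrightarrow> norm \<theta> = 1 \<Longrightarrow>
      weakly_harmonic_disc (\<lambda>\<zeta>. f (z + \<zeta> *s \<theta>)) (1 - norm z)"
    and z: "norm z < 1"
  shows "f differentiable (at z)"
proof -
  define d where "d b x = vector_derivative (\<lambda>t. f (x + t *\<^sub>R b)) (at 0)" for b x
  have d: "((\<lambda>t. f (x + t *\<^sub>R b)) has_vector_derivative d b x) (at 0)"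
    if "x \<in> ball 0 1" "b \<in> Basis" for x b
  proof -
    have x: "norm x < 1" and b: "norm b = 1" using that by auto
    have "(\<lambda>\<zeta>. f (x + \<zeta> *s b)) differentiable (at 0)"
      by (rule weakly_harmonic_disc_differentiable[OF slice[OF x b]]) (use x in simp)
    then obtain D where "((\<lambda>\<zeta>. f (x + \<zeta> *s b)) has_derivative D) (at (of_real 0))"
      unfolding differentiable_def by auto
    with has_derivative_of_real[OF has_derivative_ident]
    have "((\<lambda>t. f (x + of_real t *s b)) has_derivative (\<lambda>t. D (of_real t))) (at 0)"
      by (rule has_derivative_compose)
    then have "(\<lambda>t. f (x + t *\<^sub>R b)) differentiable (at 0)"
      unfolding of_real_scale_vec by (rule differentiableI)
    then show ?thesis unfolding d_def by (simp add: vector_derivative_works)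
  qed
  have cont_d: "continuous_on (ball 0 1) (d b)" if b: "b \<in> Basis" for b
    unfolding continuous_on_iff
  proof (intro ballI allI impI)
    fix x :: "complex^'n" and e :: real
    assume x: "x \<in> ball 0 1" and "0 < e"
    have nb: "norm b = 1" using b by simp
    \<comment> \<open>A third of the distance to the sphere leaves room for moving the centre by \<open>r\<close> and
      for a slice of radius \<open>r\<close>, at distance at least \<open>r\<close> from the sphere throughout.\<close>
    define r where "r = (1 - norm x) / 3"
    have "0 < r" and rx: "norm x = 1 - 3 * r" using x by (auto simp: r_def field_simps)
    \<comment> \<open>Chosen so that the estimate \<open>8 * \<eta> / (pi * r)\<close> becomes \<open>e / 2\<close>.\<close>
    define \<eta> where "\<eta> = pi * r * e / 16"
    have "0 < \<eta>" using \<open>0 < r\<close> \<open>0 < e\<close> by (simp add: \<eta>_def)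
    have "uniformly_continuous_on (cball 0 (1 - r)) f"
      using \<open>0 < r\<close> by (intro compact_uniformly_continuous compact_cball continuous_on_subset[OF cont]) auto
    then obtain \<delta> where \<delta>: "0 < \<delta>" "\<And>p q. p \<in> cball 0 (1 - r) \<Longrightarrow> q \<in> cball 0 (1 - r) \<Longrightarrow>
        dist p q < \<delta> \<Longrightarrow> dist (f p) (f q) < \<eta>"
      unfolding uniformly_continuous_on_def using \<open>0 < \<eta>\<close> by metis
    show "\<exists>\<delta>>0. \<forall>y\<in>ball 0 1. dist y x < \<delta> \<longrightarrow> dist (d b y) (d b x) < e"
    proof (intro exI[of _ "min \<delta> r"] conjI ballI impI)
      show "0 < min \<delta> r" using \<delta>(1) \<open>0 < r\<close> by simp
      fix y :: "complex^'n" assume y: "y \<in> ball 0 1" and yx: "dist y x < min \<delta> r"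
      have ry: "norm y \<le> 1 - 2 * r"
        using norm_triangle_ineq2[of y x] yx rx by (simp add: dist_norm)
      have "norm (d b y - d b x) \<le> 8 * \<eta> / (pi * r)"
      proof (rule directional_derivative_le_of_slices[where f = f, OF _ _ \<open>0 < r\<close> d[OF y b] d[OF x b]])
        show "weakly_harmonic_disc (\<lambda>\<zeta>. f (y + \<zeta> *s b)) r"
          using y ry \<open>0 < r\<close> by (intro weakly_harmonic_disc_mono[OF slice[OF _ nb]]) auto
        show "weakly_harmonic_disc (\<lambda>\<zeta>. f (x + \<zeta> *s b)) r"
          using x rx \<open>0 < r\<close> by (intro weakly_harmonic_disc_mono[OF slice[OF _ nb]]) auto
        fix \<zeta> :: complex assume "\<zeta> \<in> ball 0 r"
        then have \<zeta>: "norm (\<zeta> *s b) < r" by (simp add: norm_scale_vec nb)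
        have "dist (f (y + \<zeta> *s b)) (f (x + \<zeta> *s b)) < \<eta>"
        proof (rule \<delta>(2))
          show "y + \<zeta> *s b \<in> cball 0 (1 - r)"
            using norm_triangle_ineq[of y "\<zeta> *s b"] \<zeta> ry by simp
          show "x + \<zeta> *s b \<in> cball 0 (1 - r)"
            using norm_triangle_ineq[of x "\<zeta> *s b"] \<zeta> rx \<open>0 < r\<close> by simp
          show "dist (y + \<zeta> *s b) (x + \<zeta> *s b) < \<delta>" using yx by simp
        qed
        then show "norm (f (y + \<zeta> *s b) - f (x + \<zeta> *s b)) \<le> \<eta>" by (simp add: dist_norm)
      qed
      also have "\<dots> = e / 2" using \<open>0 < r\<close> by (simp add: \<eta>_def)
      also have "\<dots> < e" using \<open>0 < e\<close> by simp
      finally show "dist (d b y) (d b x) < e" by (simp add: dist_norm)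
    qed
  qed
  have "(f has_derivative (\<lambda>h. \<Sum>b\<in>Basis. (h \<bullet> b) *\<^sub>R d b z)) (at z)"
    by (rule has_derivative_continuous_directional_derivatives[OF open_ball _ d cont_d]) (use z in auto)
  then show ?thesis by (rule differentiableI)
qed

lemma pluriharmonic_mapping_differentiable:
  fixes f :: "complex^'n \<Rightarrow> complex^'m"
  assumes f: "pluriharmonic_mapping_on f (ball 0 1)" and z: "norm z < 1"
  shows "f differentiable (at z)"
proof (rule differentiable_of_harmonic_slices[OF _ pluriharmonic_slice_weakly_harmonic[OF f] z])
  have "continuous_on (ball 0 1) (\<lambda>z. \<chi> j. f z $ j)"
    using f unfolding pluriharmonic_mapping_on_def pluriharmonic_on_def
    by (intro continuous_on_vec_lambda) simp
  then show "continuous_on (ball 0 1) f" by simp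
qed

section \<open>The derivative and its extreme dilatations\<close>

text \<open>The Wirtinger matrices split the real derivative into its complex-linear and conjugate-linear
  parts: with \<open>D\<^sub>x = D (axis k 1)\<close>, \<open>D\<^sub>y = D (axis k \<i>)\<close> and \<open>\<theta>\<^sub>k = x + \<i> y\<close>, the two terms for \<open>k\<close> add
  up to \<open>x D\<^sub>x + y D\<^sub>y\<close>. Consequently \<^const>\<open>Lambda_max\<close> and \<^const>\<open>lambda_min\<close> are the
  largest and the smallest stretching factor of the derivative.\<close>

lemma jacobian_apply:
  fixes f :: "complex^'n \<Rightarrow> complex^'m"
  assumes "(f has_derivative D) (at z)"
  shows "jac_z f z *v \<theta> + jac_zbar f z *v cnj_vec \<theta> = D \<theta>"
proof (rule vec_eq_iff[THEN iffD2], rule allI)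
  fix j
  interpret D: bounded_linear D by (rule has_derivative_bounded_linear[OF assms])
  have "((\<lambda>w. f w $ j) has_derivative (\<lambda>h. D h $ j)) (at z)"
    by (rule bounded_linear.has_derivative[OF bounded_linear_vec_nth assms])
  then have dd: "deriv_dir v (\<lambda>w. f w $ j) z = D v $ j" for v
    unfolding deriv_dir_def by (simp add: frechet_derivative_at[symmetric])
  have \<theta>: "\<theta> = (\<Sum>k\<in>UNIV. Re (\<theta> $ k) *\<^sub>R axis k 1 + Im (\<theta> $ k) *\<^sub>R axis k \<i>)"
    by (simp add: vec_eq_iff axis_def if_distrib[of "\<lambda>x. _ *\<^sub>R x"] sum.distrib complex_eq_iff
        cong: if_cong)
  have "D \<theta> $ j = D (\<Sum>k\<in>UNIV. Re (\<theta> $ k) *\<^sub>R axis k 1 + Im (\<theta> $ k) *\<^sub>R axis k \<i>) $ j"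
    using \<theta> by simp
  also have "\<dots> = (\<Sum>k\<in>UNIV. Re (\<theta> $ k) *\<^sub>R (D (axis k 1) $ j) + Im (\<theta> $ k) *\<^sub>R (D (axis k \<i>) $ j))"
    by (simp add: D.sum D.add D.scaleR)
  also have "\<dots> = (\<Sum>k\<in>UNIV. wirtinger k (\<lambda>w. f w $ j) z * \<theta> $ k
      + wirtinger_bar k (\<lambda>w. f w $ j) z * cnj (\<theta> $ k))"
    unfolding wirtinger_def wirtinger_bar_def dd
    by (intro sum.cong refl) (simp add: complex_eq_iff; simp add: field_simps)
  also have "\<dots> = (jac_z f z *v \<theta> + jac_zbar f z *v cnj_vec \<theta>) $ j"
    by (simp add: matrix_vector_mult_def jac_z_def jac_zbar_def cnj_vec_def sum.distrib)
  finally show "(jac_z f z *v \<theta> + jac_zbar f z *v cnj_vec \<theta>) $ j = D \<theta> $ j" ..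
qed

lemma norm_derivative_le_Lambda_max:
  fixes f :: "complex^'n \<Rightarrow> complex^'n"
  assumes D: "(f has_derivative D) (at z)"
  shows "norm (D v) \<le> Lambda_max f z * norm v"
proof (cases "v = 0")
  case True
  then show ?thesis using bounded_linear.linear[OF has_derivative_bounded_linear[OF D]] 
    by (simp add: linear_0)
next
  case False
  interpret D: bounded_linear D by (rule has_derivative_bounded_linear[OF D])
  obtain B where B: "\<And>x. norm (D x) \<le> norm x * B" using D.bounded by blast
  have "bdd_above ((\<lambda>\<theta>. norm (D \<theta>)) ` sphere 0 1)"
    using B by (intro bdd_aboveI[of _ B]) (auto, metis mult_1)
  then have "norm (D (sgn v)) \<le> Lambda_max f z"
    unfolding Lambda_max_def jacobian_apply[OF D]
    using False by (intro cSUP_upper) (simp_all add: norm_sgn)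
  then have "norm (D (sgn v)) * norm v \<le> Lambda_max f z * norm v" by (intro mult_right_mono) auto
  moreover have "norm (D (sgn v)) * norm v = norm (D v)"
    using False by (simp add: sgn_div_norm D.scaleR)
  ultimately show ?thesis by simp
qed

lemma lambda_min_le_norm_derivative:
  fixes f :: "complex^'n \<Rightarrow> complex^'n"
  assumes D: "(f has_derivative D) (at z)"
  shows "lambda_min f z * norm v \<le> norm (D v)"
proof (cases "v = 0")
  case False
  interpret D: bounded_linear D by (rule has_derivative_bounded_linear[OF D])
  have "bdd_below ((\<lambda>\<theta>. norm (D \<theta>)) ` sphere 0 1)"
    by (intro bdd_belowI[of _ 0]) auto
  then have "lambda_min f z \<le> norm (D (sgn v))"
    unfolding lambda_min_def jacobian_apply[OF D]
    using False by (intro cINF_lower) (simp_all add: norm_sgn)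
  then have "lambda_min f z * norm v \<le> norm (D (sgn v)) * norm v" by (intro mult_right_mono) auto
  moreover have "norm (D (sgn v)) * norm v = norm (D v)"
    using False by (simp add: sgn_div_norm D.scaleR)
  ultimately show ?thesis by simp
qed simp

section \<open>Variation of the derivative\<close>

text \<open>The map \<open>z \<mapsto> D z v - D 0 v\<close> vanishes at 0 and is harmonic on complex lines through 0, so the
  Schwarz lemma applies to it. To bypass the regularity of \<open>D\<close>, the lemma is applied
  to the difference quotients of \<open>f\<close> in direction \<open>v\<close> along the line through 0 and \<open>z\<close>: these
  are harmonic because translates of slices are slices, they are bounded by the mean value
  inequality, and they live on discs whose radii tend to 1 as the increment tends to 0.\<close>

lemma derivative_variation_of_harmonic_slices:
  fixes f :: "complex^'n \<Rightarrow> 'a::real_inner"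
  assumes slice: "\<And>z \<theta>. norm z < 1 \<Longrightarrow> norm \<theta> = 1 \<Longrightarrow>
      weakly_harmonic_disc (\<lambda>\<zeta>. f (z + \<zeta> *s \<theta>)) (1 - norm z)"
    and D: "\<And>z. norm z < 1 \<Longrightarrow> (f has_derivative D z) (at z)"
    and bound: "\<And>z v. norm z < 1 \<Longrightarrow> norm (D z v) \<le> \<Lambda> * norm v"
    and z: "norm z < 1"
  shows "norm (D z v - D 0 v) \<le> 4 * (\<Lambda> * norm v + norm (D 0 v)) / pi * norm z"
proof (cases "z = 0")
  case False
  define \<theta> where "\<theta> = sgn z"
  have \<theta>: "norm \<theta> = 1" "z = of_real (norm z) *s \<theta>"
    using False by (simp_all add: \<theta>_def norm_sgn of_real_scale_vec sgn_div_norm)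
  let ?q0 = "\<lambda>h. (f (h *\<^sub>R v) - f 0) /\<^sub>R h"
  let ?qz = "\<lambda>h. (f (z + h *\<^sub>R v) - f z) /\<^sub>R h"
  have lim: "((\<lambda>h. (f (x + h *\<^sub>R v) - f x) /\<^sub>R h) \<longlongrightarrow> D x v) (at_right 0)" if "norm x < 1" for x
    using has_vector_derivative_quotient_tendsto[OF has_derivative_imp_directional[OF D[OF that], of v]]
    by (auto intro: tendsto_mono[OF at_le])
  have estimate: "norm (?qz h - ?q0 h) \<le> 4 * (\<Lambda> * norm v + norm (?q0 h)) / (pi * (1 - h * norm v)) * norm z"
    if "0 < h" and h: "h * norm v < 1 - norm z" for h
  proof -
    let ?r = "1 - h * norm v"
    have nhv: "norm (h *\<^sub>R v) = h * norm v" using \<open>0 < h\<close> by simp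
    have r: "0 < ?r" using h z norm_ge_zero[of z] by linarith
    define U where "U \<zeta> = (1 / h) *\<^sub>R ((f (h *\<^sub>R v + \<zeta> *s \<theta>) - f (0 + \<zeta> *s \<theta>)) - (f (h *\<^sub>R v) - f 0))" for \<zeta>
    have harm: "weakly_harmonic_disc U ?r"
      unfolding U_def
    proof (intro weakly_harmonic_disc_scaleR weakly_harmonic_disc_diff weakly_harmonic_disc_const)
      show "weakly_harmonic_disc (\<lambda>\<zeta>. f (h *\<^sub>R v + \<zeta> *s \<theta>)) ?r"
        using slice[of "h *\<^sub>R v", OF _ \<theta>(1)] r unfolding nhv by simp
      show "weakly_harmonic_disc (\<lambda>\<zeta>. f (0 + \<zeta> *s \<theta>)) ?r"
        by (rule weakly_harmonic_disc_mono[OF slice[OF _ \<theta>(1)]]) (use \<open>0 < h\<close> in simp_all)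
    qed
    have U0: "U 0 = 0" by (simp add: U_def)
    have "norm (U \<zeta>) \<le> \<Lambda> * norm v + norm (?q0 h)" if "\<zeta> \<in> ball 0 ?r" for \<zeta>
    proof -
      have n\<zeta>: "norm (\<zeta> *s \<theta>) < ?r" using that \<theta>(1) by (simp add: norm_scale_vec)
      have "norm (f (h *\<^sub>R v + \<zeta> *s \<theta>) - f (0 + \<zeta> *s \<theta>)) \<le> \<Lambda> * norm (h *\<^sub>R v + \<zeta> *s \<theta> - (0 + \<zeta> *s \<theta>))"
      proof (rule differentiable_bound[OF convex_ball[of 0 1]])
        show "(f has_derivative D x) (at x within ball 0 1)" if "x \<in> ball 0 1" for x
          using D[of x] that by (simp add: has_derivative_at_withinI)
        show "onorm (D x) \<le> \<Lambda>" if "x \<in> ball 0 1" for x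
          using bound[of x] that by (intro onorm_le) simp
        have "norm (h *\<^sub>R v + \<zeta> *s \<theta>) < 1"
          using norm_triangle_ineq[of "h *\<^sub>R v" "\<zeta> *s \<theta>"] n\<zeta> nhv by linarith
        then show "h *\<^sub>R v + \<zeta> *s \<theta> \<in> ball 0 1" by simp
        have "0 \<le> h * norm v" using \<open>0 < h\<close> by simp
        then have "norm (\<zeta> *s \<theta>) < 1" using n\<zeta> by linarith
        then show "0 + \<zeta> *s \<theta> \<in> ball 0 1" by simp
      qed
      then have "norm (f (h *\<^sub>R v + \<zeta> *s \<theta>) - f (0 + \<zeta> *s \<theta>)) \<le> \<Lambda> * norm v * h"
        using \<open>0 < h\<close> by (simp add: mult_ac)
      then have A: "norm ((1 / h) *\<^sub>R (f (h *\<^sub>R v + \<zeta> *s \<theta>) - f (0 + \<zeta> *s \<theta>))) \<le> \<Lambda> * norm v"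
        using \<open>0 < h\<close> by (simp add: pos_divide_le_eq)
      have eq: "U \<zeta> = (1 / h) *\<^sub>R (f (h *\<^sub>R v + \<zeta> *s \<theta>) - f (0 + \<zeta> *s \<theta>)) - ?q0 h"
        by (simp add: U_def scaleR_diff_right divide_inverse)
      show ?thesis
        unfolding eq using norm_triangle_ineq4[of "(1 / h) *\<^sub>R (f (h *\<^sub>R v + \<zeta> *s \<theta>) - f (0 + \<zeta> *s \<theta>))" "?q0 h"] A
        by linarith
    qed
    moreover have "of_real (norm z) \<in> ball (0::complex) ?r" using h by simp
    ultimately have "norm (U (of_real (norm z))) \<le>
        4 * (\<Lambda> * norm v + norm (?q0 h)) / (pi * ?r) * norm (of_real (norm z) :: complex)"
      by (intro weakly_harmonic_Schwarz[OF harm U0 r])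
    moreover have "U (of_real (norm z)) = ?qz h - ?q0 h"
      unfolding U_def \<theta>(2)[symmetric] by (simp add: scaleR_diff_right divide_inverse add.commute)
    ultimately show ?thesis by simp
  qed
  have "norm (D z v - D 0 v) \<le> 4 * (\<Lambda> * norm v + norm (D 0 v)) / (pi * (1 - 0 * norm v)) * norm z"
  proof (rule tendsto_le[of "at_right 0"])
    show "((\<lambda>h. norm (?qz h - ?q0 h)) \<longlongrightarrow> norm (D z v - D 0 v)) (at_right 0)"
      using lim[OF z] lim[of 0] by (intro tendsto_intros) simp_all
    have "((\<lambda>h. norm (?q0 h)) \<longlongrightarrow> norm (D 0 v)) (at_right 0)"
      using lim[of 0] by (intro tendsto_norm) simp
    then show "((\<lambda>h. 4 * (\<Lambda> * norm v + norm (?q0 h)) / (pi * (1 - h * norm v)) * norm z) \<longlongrightarrow>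
        4 * (\<Lambda> * norm v + norm (D 0 v)) / (pi * (1 - 0 * norm v)) * norm z) (at_right 0)"
      by (intro tendsto_mult tendsto_divide tendsto_add tendsto_diff tendsto_const tendsto_ident_at) simp_all
    have "((\<lambda>h. h * norm v) \<longlongrightarrow> 0 * norm v) (at_right 0)"
      by (intro tendsto_mult tendsto_const tendsto_ident_at)
    then have "\<forall>\<^sub>F h in at_right 0. h * norm v < 1 - norm z"
      by (rule order_tendstoD(2)) (use z in simp)
    moreover have "\<forall>\<^sub>F h in at_right 0. (0::real) < h"
      by (rule eventually_at_right_less)
    ultimately show "\<forall>\<^sub>F h in at_right 0. norm (?qz h - ?q0 h) \<le>
        4 * (\<Lambda> * norm v + norm (?q0 h)) / (pi * (1 - h * norm v)) * norm z"
      by eventually_elim (rule estimate)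
  qed simp
  then show ?thesis by simp
qed simp

section \<open>Injectivity and covering\<close>

text \<open>Let \<open>g = f - D 0\<close>. On a closed ball of radius \<open>m < \<rho>\<close> the map \<open>g\<close> is Lipschitz with constant
  \<open>m / \<rho> < 1\<close>, while \<open>D 0\<close> does not shrink distances; this gives injectivity. Integrating the
  bound along a radius gives \<open>norm (g z) \<le> \<rho> / 2\<close> on the sphere of radius \<open>\<rho>\<close>, so \<open>f\<close> maps this
  sphere outside the ball of radius \<open>\<rho> / 2\<close>. The image of the open ball is open by invariance
  of domain, and relative to the smaller ball it is also closed, hence it is everything.\<close>

lemma quantitative_inverse_function:
  fixes f :: "'a::euclidean_space \<Rightarrow> 'a"
  assumes \<rho>: "0 < \<rho>" "\<rho> < 1" and "f 0 = 0"
    and D: "\<And>z. norm z < 1 \<Longrightarrow> (f has_derivative D z) (at z)"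
    and expand: "\<And>v. norm v \<le> norm (D 0 v)"
    and variation: "\<And>z v. norm z < 1 \<Longrightarrow> norm (D z v - D 0 v) \<le> norm z / \<rho> * norm v"
  shows "inj_on f (ball 0 \<rho>)" and "ball 0 (\<rho> / 2) \<subseteq> f ` ball 0 \<rho>"
proof -
  interpret D0: bounded_linear "D 0" by (rule has_derivative_bounded_linear[OF D]) simp
  define g where "g z = f z - D 0 z" for z
  have g: "(g has_derivative (\<lambda>v. D z v - D 0 v)) (at z)" if "norm z < 1" for z
    unfolding g_def
    by (rule has_derivative_diff[OF D[OF that] bounded_linear_imp_has_derivative[OF D0.bounded_linear_axioms]])
  show inj: "inj_on f (ball 0 \<rho>)"
  proof (rule inj_onI, rule ccontr)
    fix z w assume zw: "z \<in> ball 0 \<rho>" "w \<in> ball 0 \<rho>" "f z = f w" "z \<noteq> w"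
    define m where "m = max (norm z) (norm w)"
    have m: "m < \<rho>" using zw by (simp add: m_def)
    have "norm (g z - g w) \<le> m / \<rho> * norm (z - w)"
    proof (rule differentiable_bound[OF convex_cball[of 0 m]])
      fix x :: 'a assume x: "x \<in> cball 0 m"
      then have x1: "norm x < 1" using m \<rho> by simp
      then show "(g has_derivative (\<lambda>v. D x v - D 0 v)) (at x within cball 0 m)"
        by (rule has_derivative_at_withinI[OF g])
      show "onorm (\<lambda>v. D x v - D 0 v) \<le> m / \<rho>"
      proof (rule onorm_le)
        fix v :: 'a
        have "norm x / \<rho> * norm v \<le> m / \<rho> * norm v"
          using x \<rho> by (intro mult_right_mono divide_right_mono) simp_all
        then show "norm (D x v - D 0 v) \<le> m / \<rho> * norm v"
          using variation[OF x1, of v] by linarith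
      qed
    qed (simp_all add: m_def)
    also have "\<dots> < 1 * norm (z - w)"
      using m \<rho> zw by (intro mult_strict_right_mono) simp_all
    also have "\<dots> \<le> norm (D 0 (z - w))" using expand by simp
    also have "\<dots> = norm (g z - g w)"
      using zw(3) by (simp add: g_def D0.diff norm_minus_commute)
    finally show False by simp
  qed
  have cont: "continuous_on (cball 0 \<rho>) f"
  proof (rule continuous_at_imp_continuous_on, rule ballI)
    fix x :: 'a assume "x \<in> cball 0 \<rho>"
    then show "isCont f x" using \<rho> by (intro has_derivative_continuous[OF D]) simp
  qed
  have boundary: "\<rho> / 2 \<le> norm (f z)" if z: "norm z = \<rho>" for z
  proof -
    \<comment> \<open>\<open>p\<close> majorizes the growth of \<open>g\<close> along the radius, since its derivative at \<open>t\<close> is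
      \<open>norm (t *\<^sub>R z) / \<rho> * norm z\<close>.\<close>
    define p where "p t = \<rho> / 2 * t\<^sup>2" for t :: real
    have tz: "norm (t *\<^sub>R z) < 1" if "0 \<le> t" "t \<le> 1" for t
    proof -
      have "t * \<rho> \<le> 1 * \<rho>" using that \<rho> by (intro mult_right_mono) simp_all
      then have "t * \<rho> < 1" using \<rho> by linarith
      then show ?thesis using that z by simp
    qed
    have gt: "((\<lambda>t. g (t *\<^sub>R z)) has_vector_derivative D (t *\<^sub>R z) z - D 0 z) (at t)"
      if "0 \<le> t" "t \<le> 1" for t
    proof -
      interpret Dt: bounded_linear "D (t *\<^sub>R z)" by (rule has_derivative_bounded_linear[OF D[OF tz[OF that]]])
      have "((\<lambda>t. t *\<^sub>R z) has_derivative (\<lambda>h. h *\<^sub>R z)) (at t)"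
        by (intro has_derivative_scaleR_left has_derivative_ident)
      from has_derivative_compose[OF this g[OF tz[OF that]]] show ?thesis
        by (simp add: has_vector_derivative_def Dt.scaleR D0.scaleR scaleR_diff_right)
    qed
    have "norm (g (1 *\<^sub>R z) - g (0 *\<^sub>R z)) \<le> p 1 - p 0"
    proof (rule differentiable_bound_general)
      show "continuous_on {0..1} (\<lambda>t. g (t *\<^sub>R z))"
        by (intro continuous_at_imp_continuous_on ballI has_vector_derivative_continuous[OF gt]) simp_all
      show "continuous_on {0..1} p" unfolding p_def by (intro continuous_intros)
      fix t :: real assume t: "0 < t" "t < 1"
      show "((\<lambda>t. g (t *\<^sub>R z)) has_vector_derivative D (t *\<^sub>R z) z - D 0 z) (at t)"
        using t by (intro gt) simp_all
      have "(p has_real_derivative \<rho> * t) (at t)"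
        unfolding p_def by (rule derivative_eq_intros refl | simp)+
      then show "(p has_vector_derivative \<rho> * t) (at t)"
        by (simp add: has_real_derivative_iff_has_vector_derivative)
      have "norm (D (t *\<^sub>R z) z - D 0 z) \<le> norm (t *\<^sub>R z) / \<rho> * norm z"
        using t by (intro variation tz) simp_all
      then show "norm (D (t *\<^sub>R z) z - D 0 z) \<le> \<rho> * t"
        using t z \<rho> by (simp add: mult.commute)
    qed simp
    then have "norm (g z) \<le> \<rho> / 2"
      using \<open>f 0 = 0\<close> by (simp add: p_def g_def D0.zero)
    moreover have "\<rho> \<le> norm (D 0 z)" using expand[of z] z by simp
    moreover have "norm (D 0 z) \<le> norm (f z) + norm (g z)"
      using norm_triangle_ineq4[of "f z" "g z"] by (simp add: g_def)
    ultimately show ?thesis by linarith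
  qed
  show "ball 0 (\<rho> / 2) \<subseteq> f ` ball 0 \<rho>"
  proof -
    let ?U = "f ` ball 0 \<rho>" and ?V = "- f ` cball 0 \<rho>"
    have "open ?U"
      using inj by (intro invariance_of_domain continuous_on_subset[OF cont]) simp_all
    moreover have "open ?V"
      by (intro open_Compl compact_imp_closed compact_continuous_image[OF cont] compact_cball)
    moreover have "?U \<inter> ?V \<inter> ball 0 (\<rho> / 2) = {}" by auto
    moreover have cover: "ball 0 (\<rho> / 2) \<subseteq> ?U \<union> ?V"
    proof
      fix y :: 'a assume y: "y \<in> ball 0 (\<rho> / 2)"
      show "y \<in> ?U \<union> ?V"
      proof (cases "y \<in> ?V")
        case False
        then obtain z where z: "norm z \<le> \<rho>" "y = f z" by auto
        then have "norm z \<noteq> \<rho>" using boundary[of z] y by auto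
        then show ?thesis using z by simp
      qed simp
    qed
    ultimately have "?U \<inter> ball 0 (\<rho> / 2) = {} \<or> ?V \<inter> ball 0 (\<rho> / 2) = {}"
      by (rule connectedD[OF connected_ball])
    moreover have "0 \<in> ?U \<inter> ball 0 (\<rho> / 2)"
      using \<rho> \<open>f 0 = 0\<close> by (auto intro!: image_eqI[of 0 f 0])
    ultimately have "?V \<inter> ball 0 (\<rho> / 2) = {}" by blast
    then show ?thesis using cover by blast
  qed
qed

theorem theorem3:
  fixes f :: "complex^'n \<Rightarrow> complex^'n" and K K' \<Lambda> :: real
  assumes "CARD('n) > 1"
    and "K \<ge> 1" and "K' \<ge> 0"
    and "quasiregular_pluriharmonic K K' f"
    and "f 0 = 0"
    and "lambda_min f 0 = 1"
    and "\<And>z. z \<in> ball 0 1 \<Longrightarrow> Lambda_max f z \<le> \<Lambda>"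
  shows "inj_on f (ball 0 (pi / (4 * (K + K' + \<Lambda>)))) \<and>
    ball 0 (pi / (8 * (K + K' + \<Lambda>))) \<subseteq> f ` ball 0 (pi / (4 * (K + K' + \<Lambda>)))"
proof -
  have ph: "pluriharmonic_mapping_on f (ball 0 1)"
    and qr: "Lambda_max f 0 \<le> K * lambda_min f 0 powr (1 / real CARD('n)) + K'"
    using assms(4) by (simp_all add: quasiregular_pluriharmonic_def)
  define D where "D z = frechet_derivative f (at z)" for z
  have D: "(f has_derivative D z) (at z)" if "norm z < 1" for z
    using pluriharmonic_mapping_differentiable[OF ph that] unfolding D_def
    by (simp add: frechet_derivative_works)
  have bound: "norm (D z v) \<le> \<Lambda> * norm v" if "norm z < 1" for z v
    using norm_derivative_le_Lambda_max[OF D[OF that], of v] assms(7)[of z] that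
      mult_right_mono[of "Lambda_max f z" \<Lambda> "norm v"] by simp
  have bound0: "norm (D 0 v) \<le> (K + K') * norm v" for v
    using norm_derivative_le_Lambda_max[OF D[of 0], of v] qr assms(6)
      mult_right_mono[of "Lambda_max f 0" "K + K'" "norm v"] by simp
  have expand: "norm v \<le> norm (D 0 v)" for v
    using lambda_min_le_norm_derivative[OF D[of 0], of v] assms(6) by simp
  \<comment> \<open>The derivative at 0 stretches by at least 1 and at most \<open>\<Lambda>\<close>; with \<open>1 \<le> K\<close>
    this keeps \<open>\<rho>\<close> below 1.\<close>
  have "1 \<le> \<Lambda>"
    using bound[of 0 "axis undefined 1"] expand[of "axis undefined 1"] by (simp add: norm_axis_1)
  define S where "S = K + K' + \<Lambda>"
  have "2 \<le> S" using \<open>1 \<le> \<Lambda>\<close> assms(2,3) by (simp add: S_def)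
  define \<rho> where "\<rho> = pi / (4 * S)"
  have \<rho>: "0 < \<rho>" "\<rho> < 1"
    using \<open>2 \<le> S\<close> pi_less_4 by (simp_all add: \<rho>_def)
  have variation: "norm (D z v - D 0 v) \<le> norm z / \<rho> * norm v" if z: "norm z < 1" for z v
  proof -
    have "norm (D z v - D 0 v) \<le> 4 * (\<Lambda> * norm v + norm (D 0 v)) / pi * norm z"
      by (rule derivative_variation_of_harmonic_slices
          [OF pluriharmonic_slice_weakly_harmonic[OF ph] D bound z])
    also have "\<dots> \<le> 4 * (S * norm v) / pi * norm z"
      using bound0[of v] by (intro mult_right_mono divide_right_mono) (simp_all add: S_def algebra_simps)
    also have "\<dots> = norm z / \<rho> * norm v" by (simp add: \<rho>_def mult_ac)
    finally show ?thesis .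
  qed
  have half: "pi / (8 * S) = \<rho> / 2" by (simp add: \<rho>_def)
  then show ?thesis
    using quantitative_inverse_function[OF \<rho> assms(5) D expand variation]
    unfolding S_def[symmetric] \<rho>_def[symmetric] half by blast
qed

end
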